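(* Let $\Gamma$ be a metrized graph with $\ell(\Gamma)=1$, with resistance function $r(x,y)$, and let $p,q\in\Gamma$. Then for every $\varepsilon>0$ there exists a metrized graph $\Gamma'$ with $\ell(\Gamma')=1$ such that $$\tau(\Gamma')\le\tau(\Gamma)-r(p,q)\Big(\frac14-\tau(\Gamma)\Big)+\varepsilon.$$ In particular, if $C>0$ is a constant such that $\tau(G)\ge C\,\ell(G)$ for all metrized graphs $G$, then there is no metrized graph $\beta$ with $\ell(\beta)=1$ and $\tau(\beta)=C$.
   Context: A metrized graph is a finite connected graph (multiple edges and self-loops allowed) in which each edge is identified with a closed interval of positive length; $\ell(\cdot)$ denotes total length. Regard it as a resistive circuit with segment resistance equal to length; $r(x,y)$ is the effective resistance. The tau constant is $\tau(G)=\frac14\int_G\big(\frac{\partial}{\partial x}r(x,y)\big)^2dx$ ($dx$ arclength), independent of $y$. *)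

theory Defs
  imports "HOL-Analysis.Analysis" "Graph_Theory.Digraph_Component"
begin

text \<open>
  A metrized graph is presented by an underlying finite connected multigraph (self-loops allowed)
  and a length function on its arcs.  The orientation of an arc \<open>e\<close> only fixes the
  identification of the edge with the interval \<open>[0, len \<Gamma> e]\<close>, whose end \<open>0\<close> is glued to the
  tail of \<open>e\<close> and whose other end is glued to its head.
\<close>

record ('v, 'e) mgraph =
  skeleton :: "('v, 'e) pre_digraph"
  len :: "'e \<Rightarrow> real"

definition metrized_graph :: "('v, 'e) mgraph \<Rightarrow> bool" where
  "metrized_graph \<Gamma> \<longleftrightarrow>
     fin_digraph (skeleton \<Gamma>) \<and>
     Digraph_Component.connected (skeleton \<Gamma>) \<and>
     (\<forall>e \<in> arcs (skeleton \<Gamma>). 0 < len \<Gamma> e)"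

definition total_length :: "('v, 'e) mgraph \<Rightarrow> real" where
  "total_length \<Gamma> = (\<Sum>e \<in> arcs (skeleton \<Gamma>). len \<Gamma> e)"

datatype ('v, 'e) mpoint = Vertex 'v | Inner 'e real

definition points :: "('v, 'e) mgraph \<Rightarrow> ('v, 'e) mpoint set" where
  "points \<Gamma> = Vertex ` verts (skeleton \<Gamma>) \<union>
     {Inner e t | e t. e \<in> arcs (skeleton \<Gamma>) \<and> 0 < t \<and> t < len \<Gamma> e}"

definition edge_point :: "('v, 'e) mgraph \<Rightarrow> 'e \<Rightarrow> real \<Rightarrow> ('v, 'e) mpoint" where
  "edge_point \<Gamma> e t =
     (if t = 0 then Vertex (tail (skeleton \<Gamma>) e)
      else if t = len \<Gamma> e then Vertex (head (skeleton \<Gamma>) e)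
      else Inner e t)"

text \<open>
  The resistive circuit obtained from \<open>\<Gamma>\<close> by making the points of a finite set \<open>S\<close> nodes as
  well: \<open>(e, s, t)\<close> is the segment of the edge \<open>e\<close> between two consecutive cut parameters
  \<open>s < t\<close>.
\<close>

definition cuts :: "('v, 'e) mgraph \<Rightarrow> ('v, 'e) mpoint set \<Rightarrow> 'e \<Rightarrow> real set" where
  "cuts \<Gamma> S e = {0, len \<Gamma> e} \<union> {t. Inner e t \<in> S}"

definition subdivide ::
  "('v, 'e) mgraph \<Rightarrow> ('v, 'e) mpoint set \<Rightarrow> (('v, 'e) mpoint, 'e \<times> real \<times> real) mgraph" where
  "subdivide \<Gamma> S =
     \<lparr>skeleton =
        \<lparr>verts = Vertex ` verts (skeleton \<Gamma>) \<union> S,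
         arcs = {(e, s, t). e \<in> arcs (skeleton \<Gamma>) \<and> s \<in> cuts \<Gamma> S e \<and> t \<in> cuts \<Gamma> S e \<and>
                            s < t \<and> cuts \<Gamma> S e \<inter> {s<..<t} = {}},
         tail = (\<lambda>(e, s, t). edge_point \<Gamma> e s),
         head = (\<lambda>(e, s, t). edge_point \<Gamma> e t)\<rparr>,
      len = (\<lambda>(e, s, t). t - s)\<rparr>"

text \<open>
  The net current leaving the vertex \<open>v\<close> under the vertex potential \<open>f\<close> by Ohm's law, every edge
  having resistance equal to its length.  A self-loop occurs in both sums and contributes \<open>0\<close>.
\<close>

definition net_current :: "('v, 'e) mgraph \<Rightarrow> ('v \<Rightarrow> real) \<Rightarrow> 'v \<Rightarrow> real" where
  "net_current \<Gamma> f v =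
     (\<Sum>e \<in> out_arcs (skeleton \<Gamma>) v. (f v - f (head (skeleton \<Gamma>) e)) / len \<Gamma> e) +
     (\<Sum>e \<in> in_arcs (skeleton \<Gamma>) v. (f v - f (tail (skeleton \<Gamma>) e)) / len \<Gamma> e)"

text \<open>Kirchhoff's current law when a unit current enters at \<open>x\<close> and exits at \<open>y\<close>.\<close>

definition unit_current_potential :: "('v, 'e) mgraph \<Rightarrow> 'v \<Rightarrow> 'v \<Rightarrow> ('v \<Rightarrow> real) \<Rightarrow> bool" where
  "unit_current_potential \<Gamma> x y f \<longleftrightarrow>
     (\<forall>v \<in> verts (skeleton \<Gamma>). net_current \<Gamma> f v = of_bool (v = x) - of_bool (v = y))"

definition vertex_resistance :: "('v, 'e) mgraph \<Rightarrow> 'v \<Rightarrow> 'v \<Rightarrow> real" where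
  "vertex_resistance \<Gamma> x y = (THE r. \<exists>f. unit_current_potential \<Gamma> x y f \<and> r = f x - f y)"

definition resistance :: "('v, 'e) mgraph \<Rightarrow> ('v, 'e) mpoint \<Rightarrow> ('v, 'e) mpoint \<Rightarrow> real" where
  "resistance \<Gamma> x y = vertex_resistance (subdivide \<Gamma> {x, y}) x y"

text \<open>
  The derivative is only meaningful at those interior parameters of an edge where
  the edge point differs from \<open>y\<close>; the finitely many other parameters do not affect the integral.
\<close>

definition tau_at :: "('v, 'e) mgraph \<Rightarrow> ('v, 'e) mpoint \<Rightarrow> real" where
  "tau_at \<Gamma> y = 1 / 4 *
     (\<Sum>e \<in> arcs (skeleton \<Gamma>).
        integral {0..len \<Gamma> e} (\<lambda>t. (deriv (\<lambda>s. resistance \<Gamma> (edge_point \<Gamma> e s) y) t)\<^sup>2))"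

text \<open>\<open>tau_at \<Gamma> y\<close> does not depend on the base point \<open>y\<close>, so any choice of \<open>y\<close> will do.\<close>

definition tau :: "('v, 'e) mgraph \<Rightarrow> real" where
  "tau \<Gamma> = tau_at \<Gamma> (SOME y. y \<in> points \<Gamma>)"

end

theory Submission
  imports Defs
begin

text \<open>
  For a metrized graph with vertex set containing \<open>y\<close>, \<open>\<tau>\<close> is a finite sum over the edges of expressions in the
  resistances between vertices. Replace every edge of a metrized graph \<open>G\<close> by a two-terminal network \<open>N\<^sub>e\<close>
  whose effective resistance equals the length \<open>\<ell>\<^sub>e\<close> of the edge. The resistances between old vertices do not change,
  and the resistances at new vertices are explicit, which gives exactly
  \<open>\<tau>(H) = \<tau>(G) + \<Sum>\<^sub>e (\<tau>(N\<^sub>e) - \<ell>\<^sub>e / 4 + (\<ell>\<^sub>e - r\<^sub>e) K(N\<^sub>e))\<close>, where \<open>r\<^sub>e\<close> is the resistance between the ends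
  of \<open>e\<close> in \<open>G\<close> and \<open>K\<close> is invariant under scaling. Cut \<open>\<Gamma>\<close> into \<open>n\<close> equal pieces per edge and let each piece be replaced
  by a scaled copy of \<open>\<Gamma>\<close> with terminals \<open>p, q\<close>. After normalising the length this yields
  \<open>\<tau>(\<Gamma>) - r(p, q) / 4 + r(p, q) \<tau>(\<Gamma>)\<close> up to a multiple of \<open>\<Sum>\<^sub>e (\<ell>\<^sub>e - r\<^sub>e)\<close>, and this sum is \<open>O(1 / n)\<close>
  because \<open>\<ell>\<^sub>e - r\<^sub>e\<close> is quadratic in the length of the piece.
\<close>

subsection \<open>Potentials and effective resistance\<close>

text \<open>Potentials are handled through the energy form, which is symmetric and additive over
  networks glued at terminals. A potential of \<open>H\<close> is therefore assembled from a
  potential of \<open>G\<close>, continued into each network by the normalised potential between its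
  terminals, and a source inside one network. Summed over a network, the terms that are not its own
  tau constant are mostly energies against that normalised potential, and these depend on terminal
  values alone; what resists this evaluation is \<open>K\<close>. No sign of \<open>K\<close> is
  known, so its factor has to be made small, and this is why \<open>\<Gamma>\<close> is cut finely.
  Cutting is itself a replacement of edges, by paths, whose correction vanishes; so the same formula
  shows that the vertex set does not matter, while the base point drops out by symmetry of the
  form.\<close>

abbreviation nodes :: "('v, 'e) mgraph \<Rightarrow> 'v set" where
  "nodes G \<equiv> verts (skeleton G)"

abbreviation edges :: "('v, 'e) mgraph \<Rightarrow> 'e set" where
  "edges G \<equiv> arcs (skeleton G)"

abbreviation src :: "('v, 'e) mgraph \<Rightarrow> 'e \<Rightarrow> 'v" where
  "src G \<equiv> tail (skeleton G)"

abbreviation tgt :: "('v, 'e) mgraph \<Rightarrow> 'e \<Rightarrow> 'v" where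
  "tgt G \<equiv> head (skeleton G)"

text \<open>Real functions that agree at both ends of every arc pull back along gluing maps, whereas
  paths would have to be assembled; connectedness is therefore used and verified in this form. For
  the converse, the indicator of the vertices reachable from \<open>u\<close> is such a
  function.\<close>

lemma connected_iff_locally_constant:
  assumes "wf_digraph D"
  shows "Digraph_Component.connected D \<longleftrightarrow> verts D \<noteq> {} \<and>
    (\<forall>f :: 'a \<Rightarrow> real. (\<forall>e \<in> arcs D. f (tail D e) = f (head D e)) \<longrightarrow>
       (\<forall>u \<in> verts D. \<forall>v \<in> verts D. f u = f v))" (is "?L \<longleftrightarrow> ?R")
proof
  interpret wf_digraph D by fact
  assume L: ?L
  have "f u = f v" if f: "\<forall>e \<in> arcs D. f (tail D e) = f (head D e)"
    and "u \<in> verts D" "v \<in> verts D" for f :: "'a \<Rightarrow> real" and u v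
  proof -
    have "u \<rightarrow>\<^sup>*\<^bsub>with_proj (mk_symmetric D)\<^esub> v"
      using L that unfolding Digraph_Component.connected_def strongly_connected_def by auto
    then have "(u, v) \<in> rtrancl_on (verts D) (parcs (mk_symmetric D))"
      unfolding reachable_def by auto
    then show "f u = f v"
      by (induction rule: rtrancl_on_induct) (use f in \<open>auto simp: parcs_mk_symmetric\<close>)
  qed
  then show ?R
    using L unfolding Digraph_Component.connected_def strongly_connected_def by auto
next
  interpret wf_digraph D by fact
  interpret S: pair_wf_digraph "mk_symmetric D" ..
  assume R: ?R
  have "u \<rightarrow>\<^sup>*\<^bsub>with_proj (mk_symmetric D)\<^esub> v" if uv: "u \<in> verts D" "v \<in> verts D" for u v
  proof -
    define f :: "'a \<Rightarrow> real" where
      "f w = of_bool (u \<rightarrow>\<^sup>*\<^bsub>with_proj (mk_symmetric D)\<^esub> w)" for w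
    have "f (tail D e) = f (head D e)" if "e \<in> arcs D" for e
    proof -
      have "tail D e \<rightarrow>\<^bsub>with_proj (mk_symmetric D)\<^esub> head D e"
        "head D e \<rightarrow>\<^bsub>with_proj (mk_symmetric D)\<^esub> tail D e"
        using that by (auto simp: parcs_mk_symmetric)
      then show ?thesis
        unfolding f_def by (auto dest: S.reachable_adj_trans)
    qed
    then have "f u = f v"
      using R uv by blast
    moreover have "f u = 1"
      using uv by (simp add: f_def)
    ultimately show ?thesis
      by (simp add: f_def split: if_splits)
  qed
  then show ?L
    using R unfolding Digraph_Component.connected_def strongly_connected_def by auto
qed

lemma metrized_graph_finite [simp]:
  assumes "metrized_graph G"
  shows "finite (nodes G)" "finite (edges G)"
  using assms by (auto simp: metrized_graph_def fin_digraph_def fin_digraph_axioms_def)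

lemma metrized_graph_wf [simp]:
  assumes "metrized_graph G" "e \<in> edges G"
  shows "src G e \<in> nodes G" "tgt G e \<in> nodes G" "0 < len G e"
  using assms by (auto simp: metrized_graph_def fin_digraph_def wf_digraph_def)

lemma metrized_graph_nonempty:
  assumes "metrized_graph G"
  shows "nodes G \<noteq> {}"
  using assms connected_iff_locally_constant[of "skeleton G"]
  by (auto simp: metrized_graph_def fin_digraph_def)

lemma metrized_graph_constant:
  fixes f :: "'v \<Rightarrow> real"
  assumes "metrized_graph (G :: ('v, 'e) mgraph)" "\<And>e. e \<in> edges G \<Longrightarrow> f (src G e) = f (tgt G e)"
    "u \<in> nodes G" "v \<in> nodes G"
  shows "f u = f v"
  using assms connected_iff_locally_constant[of "skeleton G"]
  by (auto simp: metrized_graph_def fin_digraph_def)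

lemma metrized_graphI:
  fixes G :: "('v, 'e) mgraph"
  assumes "finite (nodes G)" "finite (edges G)" "nodes G \<noteq> {}"
    "\<And>e. e \<in> edges G \<Longrightarrow> src G e \<in> nodes G"
    "\<And>e. e \<in> edges G \<Longrightarrow> tgt G e \<in> nodes G"
    "\<And>e. e \<in> edges G \<Longrightarrow> 0 < len G e"
    "\<And>(f :: 'v \<Rightarrow> real) u v. (\<And>e. e \<in> edges G \<Longrightarrow> f (src G e) = f (tgt G e)) \<Longrightarrow>
       u \<in> nodes G \<Longrightarrow> v \<in> nodes G \<Longrightarrow> f u = f v"
  shows "metrized_graph G"
proof -
  have wf: "wf_digraph (skeleton G)"
    using assms by unfold_locales auto
  then have "Digraph_Component.connected (skeleton G)"
    unfolding connected_iff_locally_constant[OF wf] using assms by blast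
  with wf show ?thesis
    unfolding metrized_graph_def fin_digraph_def fin_digraph_axioms_def using assms(1,2,6) by simp
qed

section \<open>The Dirichlet form and its potentials\<close>

definition energy :: "('v, 'e) mgraph \<Rightarrow> ('v \<Rightarrow> real) \<Rightarrow> ('v \<Rightarrow> real) \<Rightarrow> real" where
  "energy G f g =
     (\<Sum>e \<in> edges G. (f (tgt G e) - f (src G e)) * (g (tgt G e) - g (src G e)) / len G e)"

text \<open>Kirchhoff's law in weak form. It is linear in \<open>f\<close> and is tested globally,
  so superposition and gluing need no bookkeeping of incident edges.\<close>

definition potential :: "('v, 'e) mgraph \<Rightarrow> 'v \<Rightarrow> 'v \<Rightarrow> ('v \<Rightarrow> real) \<Rightarrow> bool" where
  "potential G x y f \<longleftrightarrow> (\<forall>g. energy G f g = g x - g y)"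

lemma potentialD: "potential G x y f \<Longrightarrow> energy G f g = g x - g y"
  by (simp add: potential_def)

lemma energy_sym: "energy G f g = energy G g f"
  by (simp add: energy_def mult.commute)

lemma energy_add: "energy G (\<lambda>v. f v + g v) h = energy G f h + energy G g h"
  unfolding energy_def sum.distrib [symmetric]
  by (rule sum.cong) (simp_all add: add_divide_distrib [symmetric] algebra_simps)

lemma energy_scale: "energy G (\<lambda>v. c * f v) h = c * energy G f h"
  unfolding energy_def sum_distrib_left
  by (rule sum.cong) (simp_all add: algebra_simps)

lemma energy_diff: "energy G (\<lambda>v. f v - g v) h = energy G f h - energy G g h"
  using energy_add[of G f "\<lambda>v. - 1 * g v" h] by (simp only: energy_scale) simp

lemma energy_const: "energy G (\<lambda>v. c) h = 0"
  by (simp add: energy_def)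

lemma energy_sum:
  "finite W \<Longrightarrow> energy G (\<lambda>u. \<Sum>v \<in> W. f v * d v u) g = (\<Sum>v \<in> W. f v * energy G (d v) g)"
  by (induction rule: finite_induct) (simp_all add: energy_const energy_add energy_scale)

lemma energy_shift: "energy G (\<lambda>v. f v - c) h = energy G f h"
  by (simp add: energy_diff energy_const)

lemma energy_cong:
  assumes "metrized_graph G" "\<And>v. v \<in> nodes G \<Longrightarrow> f v = f' v" "\<And>v. v \<in> nodes G \<Longrightarrow> g v = g' v"
  shows "energy G f g = energy G f' g'"
  unfolding energy_def by (rule sum.cong) (use assms in auto)

text \<open>Summation by parts: grouped by tail and by head, every edge is met once as outgoing and
  once as incoming, and its two terms combine to a product of differences.\<close>

lemma sum_net_current:
  assumes "metrized_graph G"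
  shows "(\<Sum>v \<in> nodes G. g v * net_current G f v) = energy G f g"
proof -
  have 1: "(\<Sum>v \<in> nodes G. g v * (\<Sum>e \<in> out_arcs (skeleton G) v. (f v - f (tgt G e)) / len G e)) =
    (\<Sum>e \<in> edges G. g (src G e) * (f (src G e) - f (tgt G e)) / len G e)" (is "?l = ?r")
  proof -
    have "?l = (\<Sum>v \<in> nodes G. \<Sum>e \<in> {e \<in> edges G. src G e = v}.
       g (src G e) * (f (src G e) - f (tgt G e)) / len G e)"
      unfolding out_arcs_def by (auto simp: sum_distrib_left intro!: sum.cong)
    also have "\<dots> = ?r"
      by (rule sum.group) (use assms in auto)
    finally show ?thesis .
  qed
  have 2: "(\<Sum>v \<in> nodes G. g v * (\<Sum>e \<in> in_arcs (skeleton G) v. (f v - f (src G e)) / len G e)) =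
    (\<Sum>e \<in> edges G. g (tgt G e) * (f (tgt G e) - f (src G e)) / len G e)" (is "?l = ?r")
  proof -
    have "?l = (\<Sum>v \<in> nodes G. \<Sum>e \<in> {e \<in> edges G. tgt G e = v}.
       g (tgt G e) * (f (tgt G e) - f (src G e)) / len G e)"
      unfolding in_arcs_def by (auto simp: sum_distrib_left intro!: sum.cong)
    also have "\<dots> = ?r"
      by (rule sum.group) (use assms in auto)
    finally show ?thesis .
  qed
  show ?thesis
    unfolding net_current_def distrib_left sum.distrib 1 2
    unfolding energy_def sum.distrib [symmetric]
    by (rule sum.cong) (simp_all add: add_divide_distrib [symmetric] algebra_simps)
qed

text \<open>Testing with the indicator of a vertex recovers the net current there; the other
  direction is summation by parts.\<close>

lemma unit_current_potential_iff:
  assumes G: "metrized_graph G" and xy: "x \<in> nodes G" "y \<in> nodes G"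
  shows "unit_current_potential G x y f \<longleftrightarrow> potential G x y f"
proof
  assume u: "unit_current_potential G x y f"
  show "potential G x y f"
    unfolding potential_def
  proof
    fix g :: "'a \<Rightarrow> real"
    have "energy G f g = (\<Sum>v \<in> nodes G. g v * (of_bool (v = x) - of_bool (v = y)))"
      using u unfolding sum_net_current[OF G, symmetric] unit_current_potential_def by simp
    also have "\<dots> = (\<Sum>v \<in> nodes G. (if v = x then g v else 0) - (if v = y then g v else 0))"
      by (rule sum.cong) auto
    also have "\<dots> = g x - g y"
      using G xy by (simp add: sum_subtractf)
    finally show "energy G f g = g x - g y" .
  qed
next
  assume p: "potential G x y f"
  have "net_current G f v = of_bool (v = x) - of_bool (v = y)" if v: "v \<in> nodes G" for v
  proof -
    have "energy G f (\<lambda>u. of_bool (u = v)) = (\<Sum>u \<in> nodes G. if u = v then net_current G f u else 0)"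
      unfolding sum_net_current[OF G, symmetric] by (rule sum.cong) auto
    also have "\<dots> = net_current G f v"
      using G v by simp
    finally show ?thesis
      using potentialD[OF p] by (simp add: eq_commute)
  qed
  then show "unit_current_potential G x y f"
    by (simp add: unit_current_potential_def)
qed

lemma energy_eq_0_imp_constant:
  assumes G: "metrized_graph G" and 0: "energy G f f = 0" and uv: "u \<in> nodes G" "v \<in> nodes G"
  shows "f u = f v"
proof (rule metrized_graph_constant[OF G _ uv])
  fix e assume e: "e \<in> edges G"
  have "(f (tgt G e) - f (src G e)) * (f (tgt G e) - f (src G e)) / len G e = 0"
    using 0 e G unfolding energy_def
    by (subst (asm) sum_nonneg_eq_0_iff) (auto intro!: divide_nonneg_pos)
  then show "f (src G e) = f (tgt G e)"
    using metrized_graph_wf(3)[OF G e] by auto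
qed

text \<open>Gaussian elimination by induction: eliminating the variable at \<open>x\<close> leaves
  the Schur complement \<open>A'\<close>, which inherits positivity.\<close>

lemma positive_definite_solvable:
  fixes A :: "'a \<Rightarrow> 'a \<Rightarrow> real"
  assumes "finite V"
    and "\<And>f. \<exists>v \<in> V. f v \<noteq> 0 \<Longrightarrow> 0 < (\<Sum>v \<in> V. \<Sum>w \<in> V. f v * A v w * f w)"
  shows "\<exists>f. \<forall>v \<in> V. (\<Sum>w \<in> V. A v w * f w) = b v"
  using assms
proof (induction V arbitrary: A b rule: finite_induct)
  case empty
  then show ?case by simp
next
  case (insert x V)
  let ?q = "\<lambda>f. \<Sum>v \<in> insert x V. \<Sum>w \<in> insert x V. f v * A v w * f w"
  have pos: "A x x > 0"
  proof -
    define g :: "'a \<Rightarrow> real" where "g v = of_bool (v = x)" for v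
    have "g v = 0" if "v \<in> V" for v
      using that insert.hyps by (auto simp: g_def)
    then have "?q g = A x x"
      using insert.hyps by (simp add: g_def [of x])
    then show ?thesis
      using insert.prems[of g] by (simp add: g_def)
  qed
  define A' where "A' v w = A v w - A v x * A x w / A x x" for v w
  have "0 < (\<Sum>v \<in> V. \<Sum>w \<in> V. f v * A' v w * f w)" if f: "\<exists>v \<in> V. f v \<noteq> 0" for f
  proof -
    define s where "s = (\<Sum>w \<in> V. A x w * f w)"
    define t where "t = (\<Sum>v \<in> V. f v * A v x)"
    \<comment> \<open>This value makes row \<open>x\<close> of \<open>A\<close> vanish on
      \<open>g\<close>, so the form at \<open>g\<close> is the form of \<open>A'\<close> at
      \<open>f\<close>.\<close>
    define g where "g = f(x := - s / A x x)"
    have g: "g v = f v" if "v \<in> V" for v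
      using that insert.hyps by (auto simp: g_def)
    have gx: "g x = - s / A x x"
      by (simp add: g_def)
    have "?q g = g x * A x x * g x + g x * s + t * g x + (\<Sum>v \<in> V. \<Sum>w \<in> V. f v * A v w * f w)"
      using insert.hyps g
      by (simp add: sum.distrib s_def t_def sum_distrib_left sum_distrib_right mult.assoc)
    also have "\<dots> = (\<Sum>v \<in> V. \<Sum>w \<in> V. f v * A v w * f w) - t * s / A x x"
      using pos by (simp add: gx field_simps)
    also have "t * s / A x x = (\<Sum>v \<in> V. \<Sum>w \<in> V. f v * (A v x * A x w / A x x) * f w)"
      by (simp add: s_def t_def sum_product sum_divide_distrib mult.assoc)
    also have "(\<Sum>v \<in> V. \<Sum>w \<in> V. f v * A v w * f w) - \<dots> = (\<Sum>v \<in> V. \<Sum>w \<in> V. f v * A' v w * f w)"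
      by (simp add: A'_def sum_subtractf [symmetric] algebra_simps)
    finally show ?thesis
      using insert.prems[of g] f g by auto
  qed
  then obtain f where f: "\<And>v. v \<in> V \<Longrightarrow>
      (\<Sum>w \<in> V. A' v w * f w) = b v - A v x * b x / A x x"
    using insert.IH[of A' "\<lambda>v. b v - A v x * b x / A x x"] by blast
  define s where "s = (\<Sum>w \<in> V. A x w * f w)"
  define g where "g = f(x := (b x - s) / A x x)"
  have g: "g v = f v" if "v \<in> V" for v
    using that insert.hyps by (auto simp: g_def)
  have gx: "g x = (b x - s) / A x x"
    by (simp add: g_def)
  have "(\<Sum>w \<in> insert x V. A v w * g w) = b v" if v: "v \<in> insert x V" for v
  proof (cases "v = x")
    case True
    then show ?thesis
      using insert.hyps pos by (simp add: gx g s_def)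
  next
    case False
    have "(\<Sum>w \<in> V. A' v w * f w) = (\<Sum>w \<in> V. A v w * f w) - A v x * s / A x x"
      by (simp add: A'_def s_def left_diff_distrib sum_subtractf sum_distrib_left sum_divide_distrib
          mult.assoc)
    with f[of v] False v have "(\<Sum>w \<in> V. A v w * f w) = b v - A v x * b x / A x x + A v x * s / A x x"
      by auto
    then show ?thesis
      using insert.hyps pos by (simp add: gx g field_simps)
  qed
  then show ?case by blast
qed

text \<open>Grounding \<open>y\<close> removes the constants, the only functions of energy zero on a
  connected graph, so the form becomes positive definite and the system with a unit source at
  \<open>x\<close> is solvable. The equation at \<open>y\<close> holds by itself, because constants
  have zero energy against everything.\<close>

lemma potential_exists:
  assumes G: "metrized_graph G" and xy: "x \<in> nodes G" "y \<in> nodes G"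
  shows "\<exists>f. potential G x y f"
proof -
  let ?V = "nodes G - {y}"
  let ?d = "\<lambda>v u. of_bool (u = v) :: real"
  let ?z = "\<lambda>f u. if u \<in> ?V then f u else 0"
  define A where "A v w = energy G (?d v) (?d w)" for v w
  have fin: "finite ?V"
    using G by simp
  have expand: "energy G (?z f) g = (\<Sum>v \<in> ?V. f v * energy G (?d v) g)" for f g
  proof -
    have "?z f u = (\<Sum>v \<in> ?V. f v * ?d v u)" for u
    proof -
      have "(\<Sum>v \<in> ?V. f v * ?d v u) = (\<Sum>v \<in> ?V. if v = u then f v else 0)"
        by (rule sum.cong) auto
      then show ?thesis
        using fin by auto
    qed
    then show ?thesis
      using energy_sum[OF fin, of G f ?d g] by presburger
  qed
  have expand2: "energy G (?d v) (?z f) = (\<Sum>w \<in> ?V. A v w * f w)" for v f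
    using expand[of f "?d v"] energy_sym[of G "?d v"] by (simp add: A_def mult.commute)
  have "\<exists>f. \<forall>v \<in> ?V. (\<Sum>w \<in> ?V. A v w * f w) = ?d x v"
  proof (rule positive_definite_solvable[OF fin])
    fix f :: "_ \<Rightarrow> real" assume f: "\<exists>v \<in> ?V. f v \<noteq> 0"
    have "(\<Sum>v \<in> ?V. \<Sum>w \<in> ?V. f v * A v w * f w) = energy G (?z f) (?z f)"
      unfolding expand expand2 by (simp add: sum_distrib_left mult.assoc)
    moreover have "energy G (?z f) (?z f) \<ge> 0"
      unfolding energy_def using G by (intro sum_nonneg divide_nonneg_pos) auto
    moreover have "energy G (?z f) (?z f) \<noteq> 0"
      using energy_eq_0_imp_constant[OF G, of "?z f" _ y] f xy by fastforce
    ultimately show "0 < (\<Sum>v \<in> ?V. \<Sum>w \<in> ?V. f v * A v w * f w)"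
      by simp
  qed
  then obtain f where f: "\<And>v. v \<in> ?V \<Longrightarrow> (\<Sum>w \<in> ?V. A v w * f w) = ?d x v"
    by blast
  have "energy G (?z f) g = g x - g y" for g
  proof -
    have "energy G (?z f) g = energy G g (?z f)"
      by (rule energy_sym)
    also have "\<dots> = energy G (\<lambda>u. g u - g y) (?z f)"
      by (simp add: energy_shift)
    also have "\<dots> = energy G (?z (\<lambda>u. g u - g y)) (?z f)"
      by (rule energy_cong[OF G]) auto
    also have "\<dots> = (\<Sum>v \<in> ?V. (g v - g y) * ?d x v)"
      unfolding expand expand2 using f by simp
    also have "\<dots> = (\<Sum>v \<in> ?V. if v = x then g v - g y else 0)"
      by (rule sum.cong) auto
    also have "\<dots> = g x - g y"
      using fin xy by auto
    finally show ?thesis .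
  qed
  then show ?thesis
    unfolding potential_def by blast
qed

lemma potential_minus: "potential G x y f \<Longrightarrow> potential G y x (\<lambda>v. - f v)"
  using energy_scale[of G "-1" f] by (simp add: potential_def)

text \<open>Reciprocity makes the definite description meaningful: testing two potentials against
  each other yields the drop of either, and the form is symmetric.\<close>

lemma vertex_resistance_eq:
  assumes G: "metrized_graph G" and xy: "x \<in> nodes G" "y \<in> nodes G" and f: "potential G x y f"
  shows "vertex_resistance G x y = f x - f y"
  unfolding vertex_resistance_def unit_current_potential_iff[OF G xy]
proof (rule the_equality)
  show "\<exists>f'. potential G x y f' \<and> f x - f y = f' x - f' y"
    using f by blast
next
  fix r assume "\<exists>f'. potential G x y f' \<and> r = f' x - f' y"
  then obtain f' where f': "potential G x y f'" and r: "r = f' x - f' y"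
    by blast
  have "energy G f f' = r"
    using potentialD[OF f] r by simp
  moreover have "energy G f' f = f x - f y"
    using potentialD[OF f'] by simp
  ultimately show "r = f x - f y"
    using energy_sym[of G f f'] by simp
qed

lemma vertex_resistance_sym:
  assumes G: "metrized_graph G" and xy: "x \<in> nodes G" "y \<in> nodes G"
  shows "vertex_resistance G x y = vertex_resistance G y x"
proof -
  obtain f where f: "potential G x y f"
    using potential_exists[OF G xy(1,2)] by blast
  from vertex_resistance_eq[OF G xy f] vertex_resistance_eq[OF G xy(2,1) potential_minus[OF f]]
  show ?thesis by simp
qed

lemma vertex_resistance_self [simp]:
  assumes G: "metrized_graph G" and x: "x \<in> nodes G"
  shows "vertex_resistance G x x = 0"
  using potential_exists[OF G x x] vertex_resistance_eq[OF G x x] by auto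

text \<open>The drop of a potential is its own energy; were it zero, the potential would be constant
  and could not carry the unit current seen by the indicator of \<open>x\<close>.\<close>

lemma vertex_resistance_pos:
  assumes G: "metrized_graph G" and xy: "x \<in> nodes G" "y \<in> nodes G" "x \<noteq> y"
  shows "0 < vertex_resistance G x y"
proof -
  obtain f where f: "potential G x y f"
    using potential_exists[OF G xy(1,2)] by blast
  have "energy G f f \<ge> 0"
    unfolding energy_def using G by (intro sum_nonneg divide_nonneg_pos) auto
  moreover have "f x - f y \<noteq> 0"
  proof
    assume "f x - f y = 0"
    then have "energy G f f = 0"
      using potentialD[OF f] by simp
    then have "energy G f (\<lambda>v. of_bool (v = x)) = energy G (\<lambda>_. f x) (\<lambda>v. of_bool (v = x))"
      using energy_eq_0_imp_constant[OF G] xy by (intro energy_cong[OF G]) blast+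
    then show False
      using potentialD[OF f, of "\<lambda>v. of_bool (v = x)"] xy by (simp add: energy_const)
  qed
  ultimately show ?thesis
    using vertex_resistance_eq[OF G xy(1,2) f] potentialD[OF f, of f] by linarith
qed

text \<open>The difference of \<open>f\<close> and the potential \<open>k\<close> from
  \<open>v\<close> to \<open>y\<close> carries a unit current from \<open>x\<close> to
  \<open>v\<close>; its drop and reciprocity between \<open>f\<close> and \<open>k\<close> determine
  the value. This is how potentials are turned into resistances.\<close>

lemma potential_value:
  assumes G: "metrized_graph G" and xy: "x \<in> nodes G" "y \<in> nodes G" "v \<in> nodes G"
    and f: "potential G x y f"
  shows "f v - f y = (vertex_resistance G x y + vertex_resistance G v y - vertex_resistance G x v) / 2"
proof -
  obtain k where k: "potential G v y k"
    using potential_exists[OF G xy(3,2)] by blast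
  have "potential G x v (\<lambda>u. f u - k u)"
    using f k by (simp add: potential_def energy_diff)
  with G xy f k have "vertex_resistance G x v = (f x - k x) - (f v - k v)"
    "vertex_resistance G x y = f x - f y" "vertex_resistance G v y = k v - k y"
    by (simp_all add: vertex_resistance_eq)
  moreover have "f v - f y = k x - k y"
    using potentialD[OF f, of k] potentialD[OF k, of f] energy_sym[of G f k] by simp
  ultimately show ?thesis by simp
qed

text \<open>By \<open>potential_value\<close> the function is twice a potential from
  \<open>x\<close> to \<open>y\<close>, up to a constant.\<close>

lemma energy_resistance_diff:
  assumes G: "metrized_graph G" and xy: "x \<in> nodes G" "y \<in> nodes G"
  shows "energy G (\<lambda>v. vertex_resistance G v y - vertex_resistance G v x) g = 2 * (g x - g y)"
proof -
  obtain f where f: "potential G x y f"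
    using potential_exists[OF G xy(1,2)] by blast
  have "2 * (g x - g y) = energy G (\<lambda>v. 2 * (f v - f y) - vertex_resistance G x y) g"
    using f by (simp add: energy_shift energy_scale potential_def)
  also have "\<dots> = energy G (\<lambda>v. vertex_resistance G v y - vertex_resistance G v x) g"
    using potential_value[OF G xy _ f] vertex_resistance_sym[OF G xy(1)]
    by (intro energy_cong[OF G]) (simp_all add: field_simps)
  finally show ?thesis by simp
qed

text \<open>Along an edge of length \<open>L\<close> with ends \<open>a, b\<close> the function \<open>r(\<cdot>, y)\<close> is a quadratic polynomial with
  leading coefficient \<open>- (L - r(a, b)) / L\<^sup>2\<close>; integrating the square of its derivative gives the summand.\<close>

definition vertex_tau :: "('v, 'e) mgraph \<Rightarrow> 'v \<Rightarrow> real" where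
  "vertex_tau G y =
     (\<Sum>e \<in> edges G.
        (vertex_resistance G (tgt G e) y - vertex_resistance G (src G e) y)\<^sup>2 / (4 * len G e) +
        (len G e - vertex_resistance G (src G e) (tgt G e))\<^sup>2 / (12 * len G e))"

lemma vertex_tau_eq_energy:
  "vertex_tau G y = energy G (\<lambda>v. vertex_resistance G v y) (\<lambda>v. vertex_resistance G v y) / 4 +
     (\<Sum>e \<in> edges G. (len G e - vertex_resistance G (src G e) (tgt G e))\<^sup>2 / (12 * len G e))"
  by (simp add: vertex_tau_def energy_def sum.distrib sum_divide_distrib power2_eq_square mult.commute)

text \<open>Only the energy of \<open>r(., y)\<close> involves the base point. The difference of two
  such energies is the energy of a difference against a sum, which
  \<open>energy_resistance_diff\<close> turns into a multiple of
  \<open>r(x, y) - r(y, x)\<close>.\<close>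

lemma vertex_tau_base_point:
  assumes G: "metrized_graph G" and xy: "x \<in> nodes G" "y \<in> nodes G"
  shows "vertex_tau G x = vertex_tau G y"
proof -
  let ?r = "vertex_resistance G"
  let ?f = "\<lambda>v. ?r v x" and ?g = "\<lambda>v. ?r v y"
  have "energy G ?g ?g - energy G ?f ?f =
      energy G (\<lambda>v. ?g v - ?f v) ?g + energy G (\<lambda>v. ?g v - ?f v) ?f"
    unfolding energy_diff using energy_sym[of G ?f ?g] by simp
  also have "\<dots> = 0"
    unfolding energy_resistance_diff[OF G xy] using G xy vertex_resistance_sym[OF G xy] by simp
  finally show ?thesis
    by (simp add: vertex_tau_eq_energy)
qed

subsection \<open>Replacing edges by networks\<close>

text \<open>The potential of a unit current from \<open>q\<close> to \<open>p\<close>, normalised to \<open>0\<close> at \<open>p\<close> and \<open>1\<close> at \<open>q\<close>.\<close>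

definition share :: "('v, 'e) mgraph \<Rightarrow> 'v \<Rightarrow> 'v \<Rightarrow> 'v \<Rightarrow> real" where
  "share G p q w = (vertex_resistance G w p + vertex_resistance G q p - vertex_resistance G w q) /
     (2 * vertex_resistance G q p)"

lemma share_simps:
  assumes "metrized_graph G" "p \<in> nodes G" "q \<in> nodes G" "vertex_resistance G q p \<noteq> 0"
  shows "share G p q p = 0" "share G p q q = 1"
  using assms vertex_resistance_sym[of G p q] by (simp_all add: share_def)

lemma energy_share:
  assumes G: "metrized_graph G" and pq: "p \<in> nodes G" "q \<in> nodes G"
    and nz: "vertex_resistance G q p \<noteq> 0"
  shows "energy G (share G p q) g = (g q - g p) / vertex_resistance G q p"
proof -
  let ?r = "vertex_resistance G q p"
  obtain f where f: "potential G q p f"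
    using potential_exists[OF G pq(2,1)] by blast
  have "energy G (share G p q) g = energy G (\<lambda>v. 1 / ?r * (f v - f p)) g"
  proof (rule energy_cong[OF G])
    fix v assume v: "v \<in> nodes G"
    show "share G p q v = 1 / ?r * (f v - f p)"
      unfolding potential_value[OF G pq(2,1) v f] share_def
      using vertex_resistance_sym[OF G v pq(2)] by (simp add: ac_simps)
  qed simp
  also have "\<dots> = (g q - g p) / ?r"
    unfolding energy_scale energy_shift potentialD[OF f] by simp
  finally show ?thesis .
qed

text \<open>In the star with ends \<open>w, p, q\<close> equivalent to the network, this is the resistance of the arm at \<open>w\<close>.\<close>

definition residual :: "('v, 'e) mgraph \<Rightarrow> 'v \<Rightarrow> 'v \<Rightarrow> 'v \<Rightarrow> real" where
  "residual G p q w = vertex_resistance G w p - vertex_resistance G q p * share G p q w"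

text \<open>The constant \<open>K\<close> of the overview: the coefficient of the deficit (length
  minus resistance between the ends) of the replaced edge that remains once all energies against
  \<open>share\<close> are evaluated.\<close>

definition distortion :: "('v, 'e) mgraph \<Rightarrow> 'v \<Rightarrow> 'v \<Rightarrow> real" where
  "distortion G p q = (\<Sum>e \<in> edges G. let c = share G p q; X = residual G p q; a = src G e; b = tgt G e in
     ((len G e - vertex_resistance G a b) * (c b - c a)\<^sup>2 - 3 * (X b - X a) * ((c b)\<^sup>2 - (c a)\<^sup>2))
       / (6 * len G e))"

text \<open>This is the contribution of one edge of an inserted network: \<open>c\<close> and
  \<open>x\<close> are the values of \<open>share\<close> and \<open>residual\<close> at its ends,
  \<open>D\<close> is the difference of \<open>r(., y)\<close> along the replaced edge and
  \<open>m\<close> the deficit of that edge. The terms are sorted so that, summed over the network,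
  they become energies, except for the square of \<open>L - r\<close> and the last one, which
  becomes \<open>m * distortion\<close>.\<close>

lemma network_edge_identity:
  fixes L r x1 x2 c1 c2 D m :: real
  assumes "L \<noteq> 0"
  shows "((x2 - x1) + (c2 - c1) * D + m * ((c2 - c2\<^sup>2) - (c1 - c1\<^sup>2)))\<^sup>2 / (4 * L) +
      (L - (r - (c2 - c1)\<^sup>2 * m))\<^sup>2 / (12 * L) =
    1 / 4 * ((x2 - x1) * (x2 - x1) / L) + (L - r)\<^sup>2 / (12 * L) +
    (D + m) / 2 * ((c2 - c1) * (x2 - x1) / L) + (D + m)\<^sup>2 / 4 * ((c2 - c1) * (c2 - c1) / L) -
    m * (D + m) / 2 * ((c2 - c1) * (c2\<^sup>2 - c1\<^sup>2) / L) +
    m\<^sup>2 / 3 * ((c2 - c1) * (c2 ^ 3 - c1 ^ 3) / L) +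
    m * (((L - r) * (c2 - c1)\<^sup>2 - 3 * (x2 - x1) * (c2\<^sup>2 - c1\<^sup>2)) / (6 * L))" (is "?l = ?r")
proof -
  \<comment> \<open>Brings the right-hand side over the common denominator \<open>12 * L\<close>,
    which leaves a polynomial identity for \<open>algebra\<close>.\<close>
  have fraction: "1 / 4 * (A / L) + B / (12 * L) + u / 2 * (C / L) + v / 4 * (E / L) - w / 2 * (F / L) +
      t / 3 * (K / L) + m * (M / (6 * L)) =
      (3 * A + B + 6 * u * C + 3 * v * E - 6 * w * F + 4 * t * K + 2 * m * M) / (12 * L)"
    for A B C E F K M u v w t
    using assms by (simp add: field_simps)
  have "?l = (3 * ((x2 - x1) + (c2 - c1) * D + m * ((c2 - c2\<^sup>2) - (c1 - c1\<^sup>2)))\<^sup>2 +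
      (L - (r - (c2 - c1)\<^sup>2 * m))\<^sup>2) / (12 * L)"
    using assms by (simp add: add_divide_distrib)
  also have "\<dots> = (3 * ((x2 - x1) * (x2 - x1)) + (L - r)\<^sup>2 + 6 * (D + m) * ((c2 - c1) * (x2 - x1)) +
      3 * (D + m)\<^sup>2 * ((c2 - c1) * (c2 - c1)) - 6 * (m * (D + m)) * ((c2 - c1) * (c2\<^sup>2 - c1\<^sup>2)) +
      4 * m\<^sup>2 * ((c2 - c1) * (c2 ^ 3 - c1 ^ 3)) +
      2 * m * ((L - r) * (c2 - c1)\<^sup>2 - 3 * (x2 - x1) * (c2\<^sup>2 - c1\<^sup>2))) / (12 * L)"
    by (rule arg_cong[where f = "\<lambda>x. x / (12 * L)"]) algebra
  also have "\<dots> = ?r"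
    by (rule fraction [symmetric])
  finally show ?thesis .
qed

text \<open>Energies against \<open>c\<close> depend only on terminal values: \<open>X\<close> is
  zero at both terminals while \<open>c\<close> goes from 0 to 1, so \<open>X\<close> contributes
  nothing and \<open>c\<close>, its square and its cube contribute \<open>1 / l\<close>
  each.\<close>

lemma network_sum:
  assumes G: "metrized_graph G" and pq: "p \<in> nodes G" "q \<in> nodes G"
    and l: "vertex_resistance G q p = l" "l \<noteq> 0"
  defines "c \<equiv> share G p q" and "X \<equiv> residual G p q"
  shows "(\<Sum>e \<in> edges G. let a = src G e; b = tgt G e in
       ((X b - X a) + (c b - c a) * D + m * ((c b - (c b)\<^sup>2) - (c a - (c a)\<^sup>2)))\<^sup>2 / (4 * len G e) +
       (len G e - (vertex_resistance G a b - (c b - c a)\<^sup>2 * m))\<^sup>2 / (12 * len G e)) =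
     vertex_tau G p - l / 4 + D\<^sup>2 / (4 * l) + m\<^sup>2 / (12 * l) + m * distortion G p q" (is "?lhs = _")
proof -
  note nz = l(2)[folded l(1)]
  have E: "energy G c g = (g q - g p) / l" for g
    using energy_share[OF G pq nz] l(1) by (simp add: c_def)
  have c: "c p = 0" "c q = 1"
    using share_simps[OF G pq nz] by (auto simp: c_def)
  have X: "X p = 0" "X q = 0"
    using c l(1) G pq by (auto simp: X_def residual_def c_def)
  have X_energy: "energy G X X = energy G (\<lambda>v. vertex_resistance G v p) (\<lambda>v. vertex_resistance G v p) - l"
  proof -
    \<comment> \<open>\<open>X\<close> and \<open>c\<close> are orthogonal, so taking
      \<open>l * c\<close> away from \<open>r(., p)\<close> lowers the energy by
      \<open>l\<^sup>2 / l\<close>.\<close>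
    have r: "(\<lambda>v. vertex_resistance G v p) = (\<lambda>v. X v + l * c v)"
      by (auto simp: X_def residual_def c_def l)
    have "energy G (\<lambda>v. X v + l * c v) (\<lambda>v. X v + l * c v) =
        energy G X (\<lambda>v. X v + l * c v) + l * energy G c (\<lambda>v. X v + l * c v)"
      by (simp add: energy_add energy_scale)
    also have "energy G X (\<lambda>v. X v + l * c v) = energy G X X + l * energy G c X"
      unfolding energy_sym[of G X "\<lambda>v. X v + l * c v"] by (simp add: energy_add energy_scale)
    finally show ?thesis
      unfolding r using l(2) by (simp add: E c X)
  qed
  have gen: "1 / 4 * (x - l) + b + (D + m) / 2 * ((0 - 0) / l) + s - t + u + z =
      x / 4 + b - l / 4 + (s - t + u) + z" for x b s t u z
    by simp
  \<comment> \<open>The products of \<open>D\<close> and \<open>m\<close> cancel and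
    \<open>1/4 - 1/2 + 1/3 = 1/12\<close>: exactly the contribution of the replaced edge
    reappears.\<close>
  have frac: "(D + m)\<^sup>2 / 4 * ((1 - 0) / l) - m * (D + m) / 2 * ((1\<^sup>2 - 0\<^sup>2) / l) +
      m\<^sup>2 / 3 * ((1 ^ 3 - 0 ^ 3) / l) = D\<^sup>2 / (4 * l) + m\<^sup>2 / (12 * l)"
    using l(2) by (simp add: field_simps power2_eq_square)
  let ?B = "\<Sum>e \<in> edges G. (len G e - vertex_resistance G (src G e) (tgt G e))\<^sup>2 / (12 * len G e)"
  have "?lhs = 1 / 4 * energy G X X + ?B +
      (D + m) / 2 * energy G c X + (D + m)\<^sup>2 / 4 * energy G c c -
      m * (D + m) / 2 * energy G c (\<lambda>v. (c v)\<^sup>2) + m\<^sup>2 / 3 * energy G c (\<lambda>v. c v ^ 3) + m * distortion G p q"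
    unfolding energy_def distortion_def sum_distrib_left sum.distrib [symmetric] sum_subtractf [symmetric]
    unfolding Let_def c_def X_def
  proof (rule sum.cong[OF refl], rule network_edge_identity)
    show "len G e \<noteq> 0" if "e \<in> edges G" for e
      using metrized_graph_wf(3)[OF G that] by simp
  qed
  also note X_energy
  finally show ?thesis
    by (simp only: E c X gen frac vertex_tau_eq_energy)
qed

text \<open>\<open>H\<close> arises from \<open>G\<close> by replacing every edge \<open>e\<close> with the network \<open>N e\<close>, whose terminals \<open>P e, Q e\<close> take
  the place of the tail and head of \<open>e\<close> and have effective resistance \<open>len G e\<close>. The assumption \<open>glue\<close> is the
  universal property of the gluing for real functions; it spares an explicit description of when
  \<open>i e w = i e' w'\<close>.\<close>

locale replacement =
  fixes G :: "('v, 'e) mgraph" and N :: "'e \<Rightarrow> ('w, 'f) mgraph" and H :: "('u, 'h) mgraph"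
    and P Q :: "'e \<Rightarrow> 'w" and j :: "'v \<Rightarrow> 'u" and i :: "'e \<Rightarrow> 'w \<Rightarrow> 'u" and k :: "'e \<Rightarrow> 'f \<Rightarrow> 'h"
  assumes G: "metrized_graph G"
    and N: "\<And>e. e \<in> edges G \<Longrightarrow> metrized_graph (N e)"
    and P: "\<And>e. e \<in> edges G \<Longrightarrow> P e \<in> nodes (N e)"
    and Q: "\<And>e. e \<in> edges G \<Longrightarrow> Q e \<in> nodes (N e)"
    and terminal_resistance: "\<And>e. e \<in> edges G \<Longrightarrow> vertex_resistance (N e) (Q e) (P e) = len G e"
    and nodes_H: "nodes H = j ` nodes G \<union> (\<Union>e \<in> edges G. i e ` nodes (N e))"
    and edges_H: "bij_betw (\<lambda>(e, a). k e a) (SIGMA e : edges G. edges (N e)) (edges H)"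
    and src_H: "\<And>e a. e \<in> edges G \<Longrightarrow> a \<in> edges (N e) \<Longrightarrow> src H (k e a) = i e (src (N e) a)"
    and tgt_H: "\<And>e a. e \<in> edges G \<Longrightarrow> a \<in> edges (N e) \<Longrightarrow> tgt H (k e a) = i e (tgt (N e) a)"
    and len_H: "\<And>e a. e \<in> edges G \<Longrightarrow> a \<in> edges (N e) \<Longrightarrow> len H (k e a) = len (N e) a"
    and i_P: "\<And>e. e \<in> edges G \<Longrightarrow> i e (P e) = j (src G e)"
    and i_Q: "\<And>e. e \<in> edges G \<Longrightarrow> i e (Q e) = j (tgt G e)"
    and glue: "\<And>(f :: 'v \<Rightarrow> real) h.
      (\<And>e. e \<in> edges G \<Longrightarrow> h e (P e) = f (src G e)) \<Longrightarrow>
      (\<And>e. e \<in> edges G \<Longrightarrow> h e (Q e) = f (tgt G e)) \<Longrightarrow>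
      \<exists>F. (\<forall>v \<in> nodes G. F (j v) = f v) \<and> (\<forall>e \<in> edges G. \<forall>w \<in> nodes (N e). F (i e w) = h e w)"
begin

abbreviation "c e \<equiv> share (N e) (P e) (Q e)"

lemma len_nz: "e \<in> edges G \<Longrightarrow> vertex_resistance (N e) (Q e) (P e) \<noteq> 0"
  using terminal_resistance metrized_graph_wf(3)[OF G] by force

lemma c_simps: "e \<in> edges G \<Longrightarrow> c e (P e) = 0" "e \<in> edges G \<Longrightarrow> c e (Q e) = 1"
  using share_simps[OF N P Q len_nz] by auto

lemma energy_c: "e \<in> edges G \<Longrightarrow> energy (N e) (c e) g = (g (Q e) - g (P e)) / len G e"
  using energy_share[OF N P Q len_nz] terminal_resistance by auto

lemma sum_edges_H: "(\<Sum>a \<in> edges H. \<phi> a) = (\<Sum>e \<in> edges G. \<Sum>a \<in> edges (N e). \<phi> (k e a))"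
  unfolding sum.reindex_bij_betw[OF edges_H, symmetric]
  by (subst sum.Sigma) (use G N in \<open>auto intro!: sum.cong\<close>)

lemma energy_H:
  "energy H f g = (\<Sum>e \<in> edges G. energy (N e) (\<lambda>w. f (i e w)) (\<lambda>w. g (i e w)))"
  unfolding energy_def sum_edges_H by (intro sum.cong refl) (simp add: src_H tgt_H len_H)

lemma edges_H_cases:
  assumes "x \<in> edges H"
  obtains e a where "e \<in> edges G" "a \<in> edges (N e)" "x = k e a"
  using assms bij_betw_imp_surj_on[OF edges_H] by force

lemma k_in_edges_H: "e \<in> edges G \<Longrightarrow> a \<in> edges (N e) \<Longrightarrow> k e a \<in> edges H"
  using bij_betw_imp_surj_on[OF edges_H] by force

lemma j_in_nodes_H: "v \<in> nodes G \<Longrightarrow> j v \<in> nodes H"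
  by (simp add: nodes_H)

lemma i_in_nodes_H: "e \<in> edges G \<Longrightarrow> w \<in> nodes (N e) \<Longrightarrow> i e w \<in> nodes H"
  by (auto simp: nodes_H)

text \<open>A function that agrees along all edges of \<open>H\<close> is constant on each network,
  hence agrees at the ends of each edge of \<open>G\<close>, hence is constant on the old
  vertices.\<close>

lemma metrized_H: "metrized_graph H"
proof (rule metrized_graphI)
  show "finite (nodes H)"
    unfolding nodes_H using G N by auto
  have "finite (SIGMA e : edges G. edges (N e))"
    using G N by auto
  then show "finite (edges H)"
    using bij_betw_finite[OF edges_H] by simp
  show "nodes H \<noteq> {}"
    using metrized_graph_nonempty[OF G] by (simp add: nodes_H)
  show "src H e \<in> nodes H" "tgt H e \<in> nodes H" "0 < len H e" if "e \<in> edges H" for e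
    using that N by (auto elim!: edges_H_cases simp: src_H tgt_H len_H intro!: i_in_nodes_H)
next
  fix f :: "'u \<Rightarrow> real" and u v
  assume f: "\<And>e. e \<in> edges H \<Longrightarrow> f (src H e) = f (tgt H e)" and uv: "u \<in> nodes H" "v \<in> nodes H"
  have local: "f (i e w) = f (i e w')" if e: "e \<in> edges G" and w: "w \<in> nodes (N e)" "w' \<in> nodes (N e)"
    for e w w'
    by (rule metrized_graph_constant[OF N[OF e], where f = "\<lambda>w. f (i e w)", OF _ w])
      (use f[OF k_in_edges_H[OF e]] e in \<open>simp add: src_H tgt_H\<close>)
  have "f (j v) = f (j v')" if v: "v \<in> nodes G" "v' \<in> nodes G" for v v'
  proof (rule metrized_graph_constant[OF G, where f = "\<lambda>v. f (j v)", OF _ v])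
    fix e assume e: "e \<in> edges G"
    show "f (j (src G e)) = f (j (tgt G e))"
      using local[OF e P[OF e] Q[OF e]] by (simp add: i_P i_Q e)
  qed
  moreover have "\<exists>v' \<in> nodes G. f v = f (j v')" if "v \<in> nodes H" for v
    using that unfolding nodes_H
  proof
    assume "v \<in> (\<Union>e \<in> edges G. i e ` nodes (N e))"
    then obtain e w where e: "e \<in> edges G" and w: "w \<in> nodes (N e)" and v: "v = i e w"
      by blast
    show ?thesis
      using local[OF e w P[OF e]] i_P[OF e] metrized_graph_wf(1)[OF G e] v by auto
  qed auto
  ultimately show "f u = f v"
    using uv by metis
qed

text \<open>Since \<open>c\<close> is harmonic off the terminals, each network carries the current
  of the edge it stands for, and testing with \<open>g\<close> sees only the old vertices.\<close>

lemma harmonic_extension: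
  obtains F where "\<And>v. v \<in> nodes G \<Longrightarrow> F (j v) = f v"
    "\<And>e w. e \<in> edges G \<Longrightarrow> w \<in> nodes (N e) \<Longrightarrow>
       F (i e w) = f (src G e) + c e w * (f (tgt G e) - f (src G e))"
    "\<And>g. energy H F g = energy G f (\<lambda>v. g (j v))"
proof -
  have "\<exists>F. (\<forall>v \<in> nodes G. F (j v) = f v) \<and> (\<forall>e \<in> edges G. \<forall>w \<in> nodes (N e).
      F (i e w) = f (src G e) + c e w * (f (tgt G e) - f (src G e)))"
    by (rule glue) (simp_all add: c_simps)
  then obtain F where F: "\<And>v. v \<in> nodes G \<Longrightarrow> F (j v) = f v"
    "\<And>e w. e \<in> edges G \<Longrightarrow> w \<in> nodes (N e) \<Longrightarrow>
       F (i e w) = f (src G e) + c e w * (f (tgt G e) - f (src G e))"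
    by blast
  moreover have "energy H F g = energy G f (\<lambda>v. g (j v))" for g
    unfolding energy_H
  proof (subst energy_def[of G], rule sum.cong[OF refl])
    fix e assume e: "e \<in> edges G"
    let ?d = "f (tgt G e) - f (src G e)"
    have "energy (N e) (\<lambda>w. F (i e w)) (\<lambda>w. g (i e w)) =
        energy (N e) (\<lambda>w. f (src G e) + ?d * c e w) (\<lambda>w. g (i e w))"
      by (rule energy_cong[OF N[OF e]]) (use F(2)[OF e] in simp_all)
    also have "\<dots> = ?d * (g (j (tgt G e)) - g (j (src G e))) / len G e"
      using e by (simp add: energy_add energy_const energy_scale energy_c i_P i_Q)
    finally show "energy (N e) (\<lambda>w. F (i e w)) (\<lambda>w. g (i e w)) =
      ?d * (g (j (tgt G e)) - g (j (src G e))) / len G e" .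
  qed
  ultimately show thesis
    using that by blast
qed

text \<open>With both terminals grounded, a unit current entering at \<open>w\<close> leaves through
  \<open>P e\<close> and \<open>Q e\<close> in the proportions \<open>1 - c\<close> and
  \<open>c\<close>. Being zero at the terminals, its potential extends by zero to the rest of
  \<open>H\<close>.\<close>

lemma local_source:
  assumes e: "e \<in> edges G" and w: "w \<in> nodes (N e)"
  obtains h where
    "\<And>g. energy H h g = g (i e w) - (1 - c e w) * g (j (src G e)) - c e w * g (j (tgt G e))"
    "\<And>v. v \<in> nodes G \<Longrightarrow> h (j v) = 0"
    "\<And>w'. w' \<in> nodes (N e) \<Longrightarrow> h (i e w') =
       (vertex_resistance (N e) w (P e) + vertex_resistance (N e) w' (P e) - vertex_resistance (N e) w w') / 2
       - c e w * c e w' * len G e"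
proof -
  let ?r = "vertex_resistance (N e)"
  obtain u where u: "potential (N e) w (P e) u"
    using potential_exists[OF N[OF e] w P[OF e]] by blast
  have uval: "u w' - u (P e) = (?r w (P e) + ?r w' (P e) - ?r w w') / 2" if "w' \<in> nodes (N e)" for w'
    by (rule potential_value[OF N[OF e] w P[OF e] that u])
  \<comment> \<open>\<open>c e w * len G e\<close> is the height of \<open>u\<close> at
    \<open>Q e\<close> above \<open>P e\<close>, so the subtraction grounds the second terminal
    too.\<close>
  define h where "h e' w' = (if e' = e then u w' - u (P e) - c e w * len G e * c e w' else 0)" for e' w'
  have nz: "len G e \<noteq> 0"
    using len_nz[OF e] terminal_resistance[OF e] by simp
  have "c e w * len G e = (?r w (P e) + len G e - ?r w (Q e)) / 2"
    using nz by (simp add: share_def terminal_resistance e)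
  then have "h e (Q e) = 0"
    using uval[OF Q[OF e]] c_simps[OF e] terminal_resistance[OF e] by (simp add: h_def)
  moreover have "h e (P e) = 0"
    using c_simps[OF e] by (simp add: h_def)
  ultimately have "h e' (P e') = 0" "h e' (Q e') = 0" for e'
    by (cases "e' = e"; simp add: h_def)+
  then have "\<exists>F. (\<forall>v \<in> nodes G. F (j v) = 0) \<and> (\<forall>e \<in> edges G. \<forall>w \<in> nodes (N e). F (i e w) = h e w)"
    by (intro glue[where f = "\<lambda>_. 0"]) auto
  then obtain F where F: "\<And>v. v \<in> nodes G \<Longrightarrow> F (j v) = 0"
    "\<And>e' w. e' \<in> edges G \<Longrightarrow> w \<in> nodes (N e') \<Longrightarrow> F (i e' w) = h e' w"
    by blast
  have "energy H F g = g (i e w) - (1 - c e w) * g (j (src G e)) - c e w * g (j (tgt G e))" for g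
  proof -
    have "energy H F g = (\<Sum>e' \<in> edges G. energy (N e') (h e') (\<lambda>w. g (i e' w)))"
      unfolding energy_H by (intro sum.cong refl energy_cong N) (auto simp: F)
    also have "\<dots> = (\<Sum>e' \<in> edges G. if e' = e then energy (N e) (h e) (\<lambda>w. g (i e w)) else 0)"
      by (rule sum.cong) (auto simp: h_def [abs_def] energy_const)
    also have "\<dots> = energy (N e) (\<lambda>w'. u w' - u (P e) - c e w * len G e * c e w') (\<lambda>w. g (i e w))"
      using e G by (simp add: h_def [abs_def])
    also have "\<dots> = g (i e w) - g (i e (P e)) - c e w * (g (i e (Q e)) - g (i e (P e)))"
      unfolding energy_diff energy_const energy_scale energy_c[OF e] potentialD[OF u] using nz by simp
    finally show ?thesis
      by (simp add: i_P i_Q e algebra_simps)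
  qed
  moreover have "F (i e w') = (?r w (P e) + ?r w' (P e) - ?r w w') / 2 - c e w * c e w' * len G e"
    if "w' \<in> nodes (N e)" for w'
    using F(2)[OF e that] uval[OF that] by (simp add: h_def)
  ultimately show thesis
    using that F(1) by blast
qed

lemma resistance_old_old:
  assumes xy: "x \<in> nodes G" "y \<in> nodes G"
  shows "vertex_resistance H (j x) (j y) = vertex_resistance G x y"
proof -
  obtain f where f: "potential G x y f"
    using potential_exists[OF G xy] by blast
  obtain F where F: "\<And>v. v \<in> nodes G \<Longrightarrow> F (j v) = f v"
    "\<And>g. energy H F g = energy G f (\<lambda>v. g (j v))"
    using harmonic_extension by metis
  have "potential H (j x) (j y) F"
    unfolding potential_def F(2) using potentialD[OF f] by simp
  from vertex_resistance_eq[OF metrized_H j_in_nodes_H[OF xy(1)] j_in_nodes_H[OF xy(2)] this]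
  show ?thesis
    using F(1) xy vertex_resistance_eq[OF G xy f] by simp
qed

text \<open>The current put in at \<open>w\<close> reaches \<open>a\<close> and \<open>b\<close> in
  the proportions given by \<open>c\<close>; the potential is the local source plus the extension of
  the corresponding mixture of \<open>fa\<close> and \<open>fb\<close>.\<close>

lemma resistance_new_old:
  assumes e: "e \<in> edges G" and w: "w \<in> nodes (N e)" and y: "y \<in> nodes G"
  defines "a \<equiv> src G e" and "b \<equiv> tgt G e"
  shows "vertex_resistance H (i e w) (j y) =
    (1 - c e w) * vertex_resistance G a y + c e w * vertex_resistance G b y
    - c e w * (1 - c e w) * vertex_resistance G a b
    + vertex_resistance (N e) w (P e) - (c e w)\<^sup>2 * len G e"
proof -
  have ab: "a \<in> nodes G" "b \<in> nodes G"
    using G e by (auto simp: a_def b_def)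
  obtain fa where fa: "potential G a y fa"
    using potential_exists[OF G ab(1) y] by blast
  obtain fb where fb: "potential G b y fb"
    using potential_exists[OF G ab(2) y] by blast
  define f where "f = (\<lambda>v. (1 - c e w) * fa v + c e w * fb v)"
  obtain F where F: "\<And>v. v \<in> nodes G \<Longrightarrow> F (j v) = f v"
    "\<And>e w. e \<in> edges G \<Longrightarrow> w \<in> nodes (N e) \<Longrightarrow>
       F (i e w) = f (src G e) + c e w * (f (tgt G e) - f (src G e))"
    "\<And>g. energy H F g = energy G f (\<lambda>v. g (j v))"
    using harmonic_extension by metis
  obtain h where h:
    "\<And>g. energy H h g = g (i e w) - (1 - c e w) * g (j a) - c e w * g (j b)"
    "\<And>v. v \<in> nodes G \<Longrightarrow> h (j v) = 0"
    "\<And>w'. w' \<in> nodes (N e) \<Longrightarrow> h (i e w') =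
       (vertex_resistance (N e) w (P e) + vertex_resistance (N e) w' (P e) - vertex_resistance (N e) w w') / 2
       - c e w * c e w' * len G e"
    using local_source[OF e w] unfolding a_def b_def by metis
  have "potential H (i e w) (j y) (\<lambda>v. F v + h v)"
    unfolding potential_def energy_add F(3) h(1) f_def energy_scale
      potentialD[OF fa] potentialD[OF fb] by (simp add: algebra_simps)
  from vertex_resistance_eq[OF metrized_H i_in_nodes_H[OF e w] j_in_nodes_H[OF y] this]
  have "vertex_resistance H (i e w) (j y) = f a + c e w * (f b - f a) - f y +
      vertex_resistance (N e) w (P e) - (c e w)\<^sup>2 * len G e"
    using w y e N[OF e] by (simp add: F h a_def b_def power2_eq_square)
  moreover have "f a - f y = (1 - c e w) * (fa a - fa y) + c e w * (fb a - fb y)"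
    "f b - f y = (1 - c e w) * (fa b - fa y) + c e w * (fb b - fb y)"
    by (simp_all add: f_def algebra_simps)
  moreover have "fa a - fa y = vertex_resistance G a y" "fb b - fb y = vertex_resistance G b y"
    using vertex_resistance_eq[OF G _ y] ab fa fb by auto
  moreover have "fa b - fa y = (vertex_resistance G a y + vertex_resistance G b y - vertex_resistance G a b) / 2"
    "fb a - fb y = (vertex_resistance G a y + vertex_resistance G b y - vertex_resistance G a b) / 2"
    using potential_value[OF G ab(1) y ab(2) fa] potential_value[OF G ab(2) y ab(1) fb]
      vertex_resistance_sym[OF G ab] by simp_all
  moreover have "f a + c e w * (f b - f a) - f y = (1 - c e w) * (f a - f y) + c e w * (f b - f y)"
    by (simp add: algebra_simps)
  moreover have "(1 - t) * ((1 - t) * r + t * ((r + s - u) / 2)) + t * ((1 - t) * ((r + s - u) / 2) + t * s) =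
      (1 - t) * r + t * s - t * (1 - t) * u" for t r s u :: real
    by (simp add: field_simps)
  ultimately show ?thesis
    by simp
qed

text \<open>The difference of the two local sources leaves a current \<open>c e w1 - c e w2\<close>
  between the terminals, which a multiple of the extended potential from head to tail cancels. That
  the correction is quadratic in the difference of shares is what makes deficits of short pieces
  quadratically small.\<close>

lemma resistance_new_new:
  assumes e: "e \<in> edges G" and w: "w1 \<in> nodes (N e)" "w2 \<in> nodes (N e)"
  shows "vertex_resistance H (i e w1) (i e w2) = vertex_resistance (N e) w1 w2
    - (c e w2 - c e w1)\<^sup>2 * (len G e - vertex_resistance G (src G e) (tgt G e))"
proof -
  let ?a = "src G e" and ?b = "tgt G e"
  have ab: "?a \<in> nodes G" "?b \<in> nodes G"
    using G e by auto
  obtain f where f: "potential G ?b ?a f"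
    using potential_exists[OF G ab(2,1)] by blast
  obtain F where F: "\<And>e w. e \<in> edges G \<Longrightarrow> w \<in> nodes (N e) \<Longrightarrow>
       F (i e w) = f (src G e) + c e w * (f (tgt G e) - f (src G e))"
    "\<And>g. energy H F g = energy G f (\<lambda>v. g (j v))"
    using harmonic_extension by metis
  obtain h1 where h1:
    "\<And>g. energy H h1 g = g (i e w1) - (1 - c e w1) * g (j ?a) - c e w1 * g (j ?b)"
    "\<And>w'. w' \<in> nodes (N e) \<Longrightarrow> h1 (i e w') =
       (vertex_resistance (N e) w1 (P e) + vertex_resistance (N e) w' (P e) - vertex_resistance (N e) w1 w') / 2
       - c e w1 * c e w' * len G e"
    using local_source[OF e w(1)] by metis
  obtain h2 where h2:
    "\<And>g. energy H h2 g = g (i e w2) - (1 - c e w2) * g (j ?a) - c e w2 * g (j ?b)"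
    "\<And>w'. w' \<in> nodes (N e) \<Longrightarrow> h2 (i e w') =
       (vertex_resistance (N e) w2 (P e) + vertex_resistance (N e) w' (P e) - vertex_resistance (N e) w2 w') / 2
       - c e w2 * c e w' * len G e"
    using local_source[OF e w(2)] by metis
  have "potential H (i e w1) (i e w2) (\<lambda>v. (c e w1 - c e w2) * F v + (h1 v - h2 v))"
    unfolding potential_def energy_add energy_diff F(2) h1(1) h2(1) energy_scale
      potentialD[OF f] by (simp add: algebra_simps)
  from vertex_resistance_eq[OF metrized_H i_in_nodes_H[OF e w(1)] i_in_nodes_H[OF e w(2)] this]
  have "vertex_resistance H (i e w1) (i e w2) = (c e w1 - c e w2)\<^sup>2 * (f ?b - f ?a) +
      vertex_resistance (N e) w1 w2 - (c e w1 - c e w2)\<^sup>2 * len G e"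
    using w e N[OF e] vertex_resistance_sym[OF N[OF e] w]
    by (simp add: F h1(2) h2(2) power2_eq_square) (simp add: field_simps)
  moreover have "f ?b - f ?a = vertex_resistance G ?a ?b"
    using vertex_resistance_eq[OF G ab(2,1) f] vertex_resistance_sym[OF G ab] by simp
  ultimately show ?thesis
    by (simp add: algebra_simps power2_eq_square)
qed

text \<open>On the network of \<open>e\<close>, the resistance to the base point is a constant plus
  \<open>X + c D + m (c - c^2)\<close>, the shape evaluated by \<open>network_sum\<close>. The
  result contains the old contribution of \<open>e\<close>, so only the correction is added.\<close>

lemma vertex_tau_H:
  assumes y: "y \<in> nodes G"
  shows "vertex_tau H (j y) = vertex_tau G y + (\<Sum>e \<in> edges G. vertex_tau (N e) (P e) - len G e / 4 +
    (len G e - vertex_resistance G (src G e) (tgt G e)) * distortion (N e) (P e) (Q e))"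
  unfolding vertex_tau_def[of H] vertex_tau_def[of G] sum_edges_H sum.distrib [where A = "edges G", symmetric]
proof (rule sum.cong[OF refl])
  fix e assume e: "e \<in> edges G"
  let ?l = "len G e" and ?r = "vertex_resistance G" and ?X = "residual (N e) (P e) (Q e)"
  let ?a = "src G e" and ?b = "tgt G e"
  define D where "D = ?r ?b y - ?r ?a y"
  define m where "m = ?l - ?r ?a ?b"
  have new_old: "vertex_resistance H (i e w) (j y) =
      ?r ?a y + ?X w + c e w * D + m * (c e w - (c e w)\<^sup>2)" if "w \<in> nodes (N e)" for w
    unfolding resistance_new_old[OF e that y] D_def m_def residual_def
    by (simp add: terminal_resistance e algebra_simps power2_eq_square)
  have "(\<Sum>a \<in> edges (N e).
      (vertex_resistance H (tgt H (k e a)) (j y) - vertex_resistance H (src H (k e a)) (j y))\<^sup>2 /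
        (4 * len H (k e a)) +
      (len H (k e a) - vertex_resistance H (src H (k e a)) (tgt H (k e a)))\<^sup>2 / (12 * len H (k e a))) =
    (\<Sum>x \<in> edges (N e). let a = src (N e) x; b = tgt (N e) x in
       ((?X b - ?X a) + (c e b - c e a) * D + m * ((c e b - (c e b)\<^sup>2) - (c e a - (c e a)\<^sup>2)))\<^sup>2
         / (4 * len (N e) x) +
       (len (N e) x - (vertex_resistance (N e) a b - (c e b - c e a)\<^sup>2 * m))\<^sup>2 / (12 * len (N e) x))"
    (is "?s = _")
  proof (rule sum.cong[OF refl])
    fix x assume x: "x \<in> edges (N e)"
    note ab = metrized_graph_wf(1,2)[OF N[OF e] x]
    have "vertex_resistance H (i e (tgt (N e) x)) (j y) - vertex_resistance H (i e (src (N e) x)) (j y) =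
        (?X (tgt (N e) x) - ?X (src (N e) x)) + (c e (tgt (N e) x) - c e (src (N e) x)) * D +
        m * ((c e (tgt (N e) x) - (c e (tgt (N e) x))\<^sup>2) - (c e (src (N e) x) - (c e (src (N e) x))\<^sup>2))"
      unfolding new_old[OF ab(1)] new_old[OF ab(2)] by (simp add: algebra_simps)
    then show "(vertex_resistance H (tgt H (k e x)) (j y) - vertex_resistance H (src H (k e x)) (j y))\<^sup>2 /
        (4 * len H (k e x)) +
      (len H (k e x) - vertex_resistance H (src H (k e x)) (tgt H (k e x)))\<^sup>2 / (12 * len H (k e x)) =
      (let a = src (N e) x; b = tgt (N e) x in
       ((?X b - ?X a) + (c e b - c e a) * D + m * ((c e b - (c e b)\<^sup>2) - (c e a - (c e a)\<^sup>2)))\<^sup>2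
         / (4 * len (N e) x) +
       (len (N e) x - (vertex_resistance (N e) a b - (c e b - c e a)\<^sup>2 * m))\<^sup>2 / (12 * len (N e) x))"
      unfolding src_H[OF e x] tgt_H[OF e x] len_H[OF e x] resistance_new_new[OF e ab] Let_def
      by (simp only: m_def)
  qed
  also have "\<dots> = vertex_tau (N e) (P e) - ?l / 4 + D\<^sup>2 / (4 * ?l) + m\<^sup>2 / (12 * ?l) +
      m * distortion (N e) (P e) (Q e)"
    using network_sum[OF N[OF e] P[OF e] Q[OF e] terminal_resistance[OF e]] len_nz[OF e]
      terminal_resistance[OF e] by simp
  finally show "?s = (?r ?b y - ?r ?a y)\<^sup>2 / (4 * ?l) + (?l - ?r ?a ?b)\<^sup>2 / (12 * ?l) +
      (vertex_tau (N e) (P e) - ?l / 4 + (?l - ?r ?a ?b) * distortion (N e) (P e) (Q e))"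
    by (simp add: D_def m_def)
qed

end

subsection \<open>Subdivision\<close>

definition consec :: "real set \<Rightarrow> (real \<times> real) set" where
  "consec C = {(s, t). s \<in> C \<and> t \<in> C \<and> s < t \<and> C \<inter> {s<..<t} = {}}"

lemma consecD: "(s, t) \<in> consec C \<Longrightarrow> s \<in> C \<and> t \<in> C \<and> s < t"
  by (simp add: consec_def)

lemma consec_disjoint: "(s, t) \<in> consec C \<Longrightarrow> c \<in> C \<Longrightarrow> c \<le> s \<or> t \<le> c"
  unfolding consec_def by force

lemma finite_consec [simp]:
  assumes "finite C"
  shows "finite (consec C)"
  by (rule finite_subset[of _ "C \<times> C"]) (use assms in \<open>auto simp: consec_def\<close>)

lemma consec_empty [simp]: "consec {} = {}"
  by (simp add: consec_def)

text \<open>Only the last gap is new; hence facts about gaps follow by the induction that adds a new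
  maximum.\<close>

lemma consec_insert_max:
  assumes "finite C" "C \<noteq> {}" "\<And>x. x \<in> C \<Longrightarrow> x < m"
  shows "consec (insert m C) = insert (Max C, m) (consec C)"
proof (intro equalityI subsetI)
  fix p assume "p \<in> consec (insert m C)"
  then obtain s t where p: "p = (s, t)" and st: "(s, t) \<in> consec (insert m C)"
    by (cases p) auto
  have s: "s \<in> C"
    using consecD[OF st] assms(3)[of t] by auto
  show "p \<in> insert (Max C, m) (consec C)"
  proof (cases "t = m")
    case True
    have "Max C \<le> s"
      using consec_disjoint[OF st, of "Max C"] assms Max_in[OF assms(1,2)] True by fastforce
    then have "s = Max C"
      using Max_ge[OF assms(1) s] by simp
    with True p show ?thesis by simp
  next
    case False
    then show ?thesis
      using st s p by (auto simp: consec_def)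
  qed
next
  fix p assume "p \<in> insert (Max C, m) (consec C)"
  then show "p \<in> consec (insert m C)"
    using Max_in[OF assms(1,2)] assms(3) Max_ge[OF assms(1)] unfolding consec_def by fastforce
qed

lemma not_consec_max:
  assumes "\<And>x. x \<in> C \<Longrightarrow> x < m"
  shows "(s, m) \<notin> consec C"
  using assms[of m] by (auto dest: consecD)

lemma consec_singleton [simp]: "consec {a} = {}"
  by (auto simp: consec_def)

lemma Max_Min_insert:
  assumes "finite A" "A \<noteq> {}" "\<And>x. x \<in> A \<Longrightarrow> x < (b :: real)"
  shows "Max (insert b A) = b" "Min (insert b A) = Min A"
proof -
  show "Max (insert b A) = b"
    by (rule Max_eqI) (use assms in \<open>auto intro: less_imp_le\<close>)
  have "Min A \<le> b"
    using assms(3)[OF Min_in[OF assms(1,2)]] by (rule less_imp_le)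
  then show "Min (insert b A) = Min A"
    unfolding Min_insert[OF assms(1,2)] by (rule min_absorb2)
qed

lemma sum_consec:
  assumes "finite C" "C \<noteq> {}"
  shows "(\<Sum>(s, t) \<in> consec C. g t - g s) = (g (Max C) - g (Min C) :: real)"
  using assms
proof (induction rule: finite_linorder_max_induct)
  case (insert b A)
  show ?case
  proof (cases "A = {}")
    case False
    have "Max (insert b A) = b" "Min (insert b A) = Min A"
      using Max_Min_insert[of A b] insert.hyps False by simp_all
    then show ?thesis
      using insert.IH insert.hyps False by (simp add: consec_insert_max not_consec_max)
  qed simp
qed simp

lemma has_integral_consec:
  fixes F :: "real \<Rightarrow> real"
  assumes "finite C" "C \<noteq> {}" "\<And>s t. (s, t) \<in> consec C \<Longrightarrow> (F has_integral I (s, t)) {s..t}"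
  shows "(F has_integral (\<Sum>p \<in> consec C. I p)) {Min C..Max C}"
  using assms
proof (induction rule: finite_linorder_max_induct)
  case (insert b A)
  show ?case
  proof (cases "A = {}")
    case True
    then show ?thesis
      by (simp add: has_integral_refl)
  next
    case False
    have Mx: "Max (insert b A) = b" "Min (insert b A) = Min A"
      using Max_Min_insert[of A b] insert.hyps False by simp_all
    have c: "consec (insert b A) = insert (Max A, b) (consec A)"
      using insert.hyps False by (intro consec_insert_max) auto
    have "(F has_integral (\<Sum>p \<in> consec A. I p)) {Min A..Max A}"
      using insert.IH[OF False] insert.prems(2) c by auto
    moreover have "(F has_integral I (Max A, b)) {Max A..b}"
      using insert.prems c by simp
    moreover have "Min A \<le> Max A" "Max A \<le> b"
      using insert.hyps False by (auto intro: less_imp_le)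
    ultimately have "(F has_integral (\<Sum>p \<in> consec A. I p) + I (Max A, b)) {Min A..b}"
      by (intro has_integral_combine)
    moreover have "(\<Sum>p \<in> insert (Max A, b) (consec A). I p) = (\<Sum>p \<in> consec A. I p) + I (Max A, b)"
      using insert.hyps not_consec_max[of A b "Max A"] by (simp add: add.commute)
    ultimately show ?thesis
      unfolding Mx c by simp
  qed
qed simp

lemma consec_constant:
  assumes "finite C" "\<And>s t. (s, t) \<in> consec C \<Longrightarrow> f s = f t" "u \<in> C" "v \<in> C"
  shows "f u = f v"
  using assms
proof (induction arbitrary: u v rule: finite_linorder_max_induct)
  case (insert b A)
  show ?case
  proof (cases "A = {}")
    case False
    have c: "consec (insert b A) = insert (Max A, b) (consec A)"
      using insert.hyps False by (intro consec_insert_max) auto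
    have A: "f u = f v" if "u \<in> A" "v \<in> A" for u v
    proof (rule insert.IH[OF _ that])
      show "f s = f t" if "(s, t) \<in> consec A" for s t
        by (rule insert.prems(1)) (use that c in simp)
    qed
    have "f (Max A) = f b"
      by (rule insert.prems(1)) (simp add: c)
    then have "f w = f b" if "w \<in> insert b A" for w
      by (cases "w = b") (use that A[of w "Max A"] Max_in[OF insert.hyps(1) False] in auto)
    then show ?thesis
      using insert.prems(2,3) by metis
  qed (use insert.prems(2,3) in simp)
qed simp

text \<open>The witnesses are the greatest element up to \<open>u\<close> and the least one above.
  Gaps count as closed on the left and open on the right, which makes the choice unique even for
  \<open>u\<close> in \<open>C\<close>.\<close>

lemma consec_cover:
  assumes C: "finite C" "a \<in> C" "b \<in> C" and u: "a \<le> u" "u < b"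
  obtains s t where "(s, t) \<in> consec C" "s \<le> u" "u < t"
proof -
  let ?A = "{x \<in> C. x \<le> u}" and ?B = "{x \<in> C. u < x}"
  have "finite ?A" "?A \<noteq> {}" "finite ?B" "?B \<noteq> {}"
    using assms by auto
  then have M: "Max ?A \<in> ?A" "Min ?B \<in> ?B" "\<And>x. x \<in> ?A \<Longrightarrow> x \<le> Max ?A" "\<And>x. x \<in> ?B \<Longrightarrow> Min ?B \<le> x"
    using Max_in Min_in by (blast, blast, auto)
  have "C \<inter> {Max ?A<..<Min ?B} = {}"
  proof (rule ccontr)
    assume "C \<inter> {Max ?A<..<Min ?B} \<noteq> {}"
    then obtain x where x: "x \<in> C" "Max ?A < x" "x < Min ?B"
      by auto
    show False
      using x M(3)[of x] M(4)[of x] by (cases "x \<le> u") auto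
  qed
  then have "(Max ?A, Min ?B) \<in> consec C"
    using M(1,2) by (auto simp: consec_def)
  then show thesis
    using that M(1,2) by blast
qed

lemma consec_unique:
  assumes "(s, t) \<in> consec C" "s \<le> u" "u < t" "(s', t') \<in> consec C" "s' \<le> u" "u < t'"
  shows "s = s'" "t = t'"
proof -
  note D = consecD[OF assms(1)] consecD[OF assms(4)]
  have "s' \<le> s \<or> t \<le> s'" "t' \<le> s \<or> t \<le> t'" "s \<le> s' \<or> t' \<le> s" "t \<le> s' \<or> t' \<le> t"
    using consec_disjoint[OF assms(1)] consec_disjoint[OF assms(4)] D by blast+
  then show "s = s'" "t = t'"
    using assms(2,3,5,6) by linarith+
qed

text \<open>A gap of \<open>C'\<close> is located by its left end: if it starts in
  \<open>[s, t)\<close>, it cannot cross \<open>t\<close>, which belongs to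
  \<open>C'\<close>.\<close>

lemma consec_refine_iff:
  assumes "C \<subseteq> C'" "(s, t) \<in> consec C"
  shows "(u, v) \<in> consec (C' \<inter> {s..t}) \<longleftrightarrow> (u, v) \<in> consec C' \<and> s \<le> u \<and> u < t"
proof
  assume "(u, v) \<in> consec (C' \<inter> {s..t})"
  then show "(u, v) \<in> consec C' \<and> s \<le> u \<and> u < t"
    unfolding consec_def by force
next
  assume uv: "(u, v) \<in> consec C' \<and> s \<le> u \<and> u < t"
  then have "v \<le> t"
    using consec_disjoint[of u v C' t] consecD[OF assms(2)] assms(1) by auto
  with uv show "(u, v) \<in> consec (C' \<inter> {s..t})"
    unfolding consec_def by auto
qed

text \<open>The network that replaces an edge under subdivision: a path whose vertices are the cut
  parameters themselves, so that \<open>edge_point\<close> maps it into place.\<close>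

definition interval_graph :: "real set \<Rightarrow> (real, real \<times> real) mgraph" where
  "interval_graph C =
     \<lparr>skeleton = \<lparr>verts = C, arcs = consec C, tail = fst, head = snd\<rparr>, len = (\<lambda>(s, t). t - s)\<rparr>"

lemma interval_graph_simps [simp]:
  "nodes (interval_graph C) = C" "edges (interval_graph C) = consec C"
  "src (interval_graph C) = fst" "tgt (interval_graph C) = snd"
  "len (interval_graph C) (s, t) = t - s"
  by (simp_all add: interval_graph_def)

lemma metrized_interval_graph:
  assumes "finite C" "C \<noteq> {}"
  shows "metrized_graph (interval_graph C)"
proof (rule metrized_graphI)
  fix f :: "real \<Rightarrow> real" and u v
  assume "\<And>e. e \<in> edges (interval_graph C) \<Longrightarrow> f (src (interval_graph C) e) = f (tgt (interval_graph C) e)"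
    "u \<in> nodes (interval_graph C)" "v \<in> nodes (interval_graph C)"
  then show "f u = f v"
    using consec_constant[OF assms(1), of f u v] by fastforce
qed (use assms in \<open>auto dest: consecD\<close>)

lemma resistance_interval_graph:
  assumes C: "finite C" "s \<in> C" "t \<in> C"
  shows "vertex_resistance (interval_graph C) s t = \<bar>s - t\<bar>"
proof -
  have ne: "C \<noteq> {}"
    using C by auto
  note G = metrized_interval_graph[OF C(1) ne]
  have le: "vertex_resistance (interval_graph C) x y = y - x" if xy: "x \<in> C" "y \<in> C" "x \<le> y" for x y
  proof -
    \<comment> \<open>The coordinate clamped to \<open>[x, y]\<close>, to be negated because a
      potential falls along the current. Its slope is 1 on gaps inside and 0 outside, so the energy
      telescopes.\<close>
    define cl where "cl u = min (max u x) y" for u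
    have "potential (interval_graph C) x y (\<lambda>u. - cl u)"
      unfolding potential_def
    proof
      fix g :: "real \<Rightarrow> real"
      have "energy (interval_graph C) (\<lambda>u. - cl u) g = (\<Sum>(u, v) \<in> consec C. - g (cl v) - - g (cl u))"
        unfolding energy_def interval_graph_simps
      proof (rule sum.cong[OF refl], clarify)
        fix u v assume uv: "(u, v) \<in> consec C"
        have "v \<le> x \<or> y \<le> u \<or> (x \<le> u \<and> v \<le> y)"
          using consec_disjoint[OF uv] xy by blast
        then consider "v \<le> x" | "y \<le> u" | "x \<le> u" "v \<le> y"
          by blast
        then show "(- cl (snd (u, v)) - - cl (fst (u, v))) * (g (snd (u, v)) - g (fst (u, v))) /
            len (interval_graph C) (u, v) = - g (cl v) - - g (cl u)"
          using consecD[OF uv] xy by cases (simp_all add: cl_def divide_simps algebra_simps)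
      qed
      also have "\<dots> = - g (cl (Max C)) - - g (cl (Min C))"
        by (rule sum_consec[OF C(1) ne])
      also have "cl (Max C) = y"
        using Max_ge[OF C(1) xy(2)] xy by (simp add: cl_def)
      also have "cl (Min C) = x"
        using Min_le[OF C(1) xy(1)] xy by (simp add: cl_def)
      finally show "energy (interval_graph C) (\<lambda>u. - cl u) g = g x - g y"
        by simp
    qed
    from vertex_resistance_eq[OF G _ _ this] show ?thesis
      using xy by (simp add: cl_def)
  qed
  show ?thesis
    using le[OF C(2,3)] le[OF C(3,2)] vertex_resistance_sym[OF G] C by (cases "s \<le> t") auto
qed

lemma share_interval_graph:
  assumes "finite C" "s \<in> C" "t \<in> C" "s < t" "w \<in> C" "s \<le> w" "w \<le> t"
  shows "share (interval_graph C) s t w = (w - s) / (t - s)"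
  using assms by (simp add: share_def resistance_interval_graph field_simps)

text \<open>Every edge of a path is a bridge and has no deficit; every vertex lies between the
  terminals, so \<open>residual\<close> vanishes.\<close>

lemma distortion_interval_graph:
  assumes C: "finite C" "s \<in> C" "t \<in> C" "s < t" "C \<subseteq> {s..t}"
  shows "distortion (interval_graph C) s t = 0"
proof -
  have X: "residual (interval_graph C) s t w = 0" if "w \<in> C" for w
    using assms that subsetD[OF C(5) that]
    by (simp add: residual_def share_interval_graph resistance_interval_graph)
  show ?thesis
    unfolding distortion_def
    by (rule sum.neutral) (use C in \<open>auto simp: Let_def X resistance_interval_graph dest: consecD\<close>)
qed

text \<open>The resistance to \<open>s\<close> has slope 1 and no edge has a deficit, so each gap
  contributes a quarter of its length.\<close>

lemma vertex_tau_interval_graph: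
  assumes C: "finite C" "s \<in> C" "t \<in> C" "C \<subseteq> {s..t}"
  shows "vertex_tau (interval_graph C) s = (t - s) / 4"
proof -
  have quad: "0 < d \<Longrightarrow> d\<^sup>2 / (4 * d) + (d - d)\<^sup>2 / (12 * d) = d / 4" for d :: real
    by (simp add: power2_eq_square)
  have "vertex_tau (interval_graph C) s = (\<Sum>(u, v) \<in> consec C. v / 4 - u / 4)"
    unfolding vertex_tau_def interval_graph_simps
  proof (rule sum.cong[OF refl], clarify)
    fix u v assume uv: "(u, v) \<in> consec C"
    note D = consecD[OF uv]
    have "s \<le> u" "s \<le> v"
      using D C by auto
    then have "vertex_resistance (interval_graph C) v s - vertex_resistance (interval_graph C) u s = v - u"
      "vertex_resistance (interval_graph C) u v = v - u"
      using D C by (simp_all add: resistance_interval_graph)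
    then show "(vertex_resistance (interval_graph C) (snd (u, v)) s -
        vertex_resistance (interval_graph C) (fst (u, v)) s)\<^sup>2 / (4 * len (interval_graph C) (u, v)) +
      (len (interval_graph C) (u, v) -
        vertex_resistance (interval_graph C) (fst (u, v)) (snd (u, v)))\<^sup>2 /
      (12 * len (interval_graph C) (u, v)) = v / 4 - u / 4"
      using quad[of "v - u"] D
      by (simp only: fst_conv snd_conv interval_graph_simps diff_divide_distrib diff_gt_0_iff_gt)
  qed
  also have "\<dots> = Max C / 4 - Min C / 4"
    using C by (intro sum_consec) auto
  also have "Max C = t"
    using C by (intro Max_eqI) auto
  also have "Min C = s"
    using C by (intro Min_eqI) auto
  finally show ?thesis
    by (simp add: diff_divide_distrib)
qed

section \<open>Subdivision as replacement by paths\<close>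

lemma subdivide_simps [simp]:
  "nodes (subdivide \<Gamma> S) = Vertex ` nodes \<Gamma> \<union> S"
  "edges (subdivide \<Gamma> S) = (SIGMA e : edges \<Gamma>. consec (cuts \<Gamma> S e))"
  "src (subdivide \<Gamma> S) (e, s, t) = edge_point \<Gamma> e s"
  "tgt (subdivide \<Gamma> S) (e, s, t) = edge_point \<Gamma> e t"
  "len (subdivide \<Gamma> S) (e, s, t) = t - s"
  by (auto simp: subdivide_def consec_def)

lemma cuts_ends [simp]: "0 \<in> cuts \<Gamma> S e" "len \<Gamma> e \<in> cuts \<Gamma> S e"
  by (simp_all add: cuts_def)

lemma cuts_nonempty [simp]: "cuts \<Gamma> S e \<noteq> {}"
  by (simp add: cuts_def)

lemma finite_cuts [simp]:
  assumes "finite S"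
  shows "finite (cuts \<Gamma> S e)"
proof -
  have "{t. Inner e t \<in> S} \<subseteq> (\<lambda>x. case x of Inner _ t \<Rightarrow> t | Vertex _ \<Rightarrow> 0) ` S"
    by force
  then show ?thesis
    using assms unfolding cuts_def by (meson finite.intros finite_Un finite_imageI finite_subset)
qed

lemma cuts_subset:
  assumes "metrized_graph \<Gamma>" "S \<subseteq> points \<Gamma>" "e \<in> edges \<Gamma>"
  shows "cuts \<Gamma> S e \<subseteq> {0..len \<Gamma> e}"
  using assms less_imp_le[OF metrized_graph_wf(3)[OF assms(1,3)]] by (auto simp: cuts_def points_def)

lemma cuts_mono: "S \<subseteq> S' \<Longrightarrow> cuts \<Gamma> S e \<subseteq> cuts \<Gamma> S' e"
  by (auto simp: cuts_def)

lemma edge_point_in_nodes: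
  assumes "metrized_graph \<Gamma>" "e \<in> edges \<Gamma>" "t \<in> cuts \<Gamma> S e"
  shows "edge_point \<Gamma> e t \<in> nodes (subdivide \<Gamma> S)"
  using assms by (auto simp: cuts_def edge_point_def)

text \<open>The terminals are the parameters 0 and \<open>len \<Gamma> e\<close>. An inner point
  belongs to one edge only, so \<open>glue\<close> merely joins \<open>f\<close> and
  \<open>h\<close>.\<close>

lemma replacement_subdivide:
  fixes \<Gamma> :: "('v, 'e) mgraph"
  assumes \<Gamma>: "metrized_graph \<Gamma>" and S: "finite S" "S \<subseteq> points \<Gamma>"
  shows "replacement \<Gamma> (\<lambda>e. interval_graph (cuts \<Gamma> S e)) (subdivide \<Gamma> S) (\<lambda>_. 0) (len \<Gamma>) Vertex
    (edge_point \<Gamma>) Pair"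
proof
  show "metrized_graph \<Gamma>" by fact
  fix e assume e: "e \<in> edges \<Gamma>"
  show "metrized_graph (interval_graph (cuts \<Gamma> S e))"
    using finite_cuts[OF S(1)] by (rule metrized_interval_graph) (simp add: cuts_def)
  show "vertex_resistance (interval_graph (cuts \<Gamma> S e)) (len \<Gamma> e) 0 = len \<Gamma> e"
    using S metrized_graph_wf(3)[OF \<Gamma> e] by (simp add: resistance_interval_graph)
  show "edge_point \<Gamma> e 0 = Vertex (src \<Gamma> e)" "edge_point \<Gamma> e (len \<Gamma> e) = Vertex (tgt \<Gamma> e)"
    using metrized_graph_wf(3)[OF \<Gamma> e] by (auto simp: edge_point_def)
next
  show "nodes (subdivide \<Gamma> S) = Vertex ` nodes \<Gamma> \<union>
      (\<Union>e \<in> edges \<Gamma>. edge_point \<Gamma> e ` nodes (interval_graph (cuts \<Gamma> S e)))" (is "?l = ?r")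
  proof (rule equalityI; rule subsetI)
    fix x assume "x \<in> ?r"
    then show "x \<in> ?l"
    proof
      assume "x \<in> (\<Union>e \<in> edges \<Gamma>. edge_point \<Gamma> e ` nodes (interval_graph (cuts \<Gamma> S e)))"
      then obtain e u where "e \<in> edges \<Gamma>" "u \<in> cuts \<Gamma> S e" "x = edge_point \<Gamma> e u"
        by auto
      then show ?thesis
        using edge_point_in_nodes[OF \<Gamma>] by blast
    qed auto
  next
    fix x assume x: "x \<in> ?l"
    show "x \<in> ?r"
    proof (cases x)
      case (Inner e t)
      then have "x \<in> S"
        using x by auto
      then have "e \<in> edges \<Gamma>" "0 < t" "t < len \<Gamma> e" "t \<in> cuts \<Gamma> S e"
        using S Inner by (auto simp: points_def cuts_def)
      moreover from this have "x = edge_point \<Gamma> e t"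
        by (simp add: Inner edge_point_def)
      ultimately show ?thesis by auto
    qed (use x S in \<open>auto simp: points_def\<close>)
  qed
next
  show "bij_betw (\<lambda>(e, a). (e, a)) (SIGMA e : edges \<Gamma>. edges (interval_graph (cuts \<Gamma> S e)))
      (edges (subdivide \<Gamma> S))"
    by (simp add: bij_betw_def inj_on_def)
next
  fix f :: "'v \<Rightarrow> real" and h
  assume h: "\<And>e. e \<in> edges \<Gamma> \<Longrightarrow> h e 0 = f (src \<Gamma> e)"
    "\<And>e. e \<in> edges \<Gamma> \<Longrightarrow> h e (len \<Gamma> e) = f (tgt \<Gamma> e)"
  show "\<exists>F. (\<forall>v \<in> nodes \<Gamma>. F (Vertex v) = f v) \<and>
    (\<forall>e \<in> edges \<Gamma>. \<forall>w \<in> nodes (interval_graph (cuts \<Gamma> S e)). F (edge_point \<Gamma> e w) = h e w)"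
    by (rule exI[of _ "\<lambda>x. case x of Vertex v \<Rightarrow> f v | Inner e t \<Rightarrow> h e t"])
      (use h in \<open>auto simp: edge_point_def\<close>)
qed (simp_all add: split_paired_all)

lemma metrized_subdivide:
  assumes "metrized_graph \<Gamma>" "finite S" "S \<subseteq> points \<Gamma>"
  shows "metrized_graph (subdivide \<Gamma> S)"
  using replacement.metrized_H[OF replacement_subdivide[OF assms]] .

text \<open>For a path both parts of the correction vanish, since its tau constant is a quarter of
  its length and its distortion is zero.\<close>

lemma vertex_tau_subdivide:
  assumes \<Gamma>: "metrized_graph \<Gamma>" and S: "finite S" "S \<subseteq> points \<Gamma>" and y: "y \<in> nodes \<Gamma>"
  shows "vertex_tau (subdivide \<Gamma> S) (Vertex y) = vertex_tau \<Gamma> y"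
proof -
  have tau_i: "vertex_tau (interval_graph (cuts \<Gamma> S e)) 0 = len \<Gamma> e / 4"
    "distortion (interval_graph (cuts \<Gamma> S e)) 0 (len \<Gamma> e) = 0" if "e \<in> edges \<Gamma>" for e
    using S cuts_subset[OF \<Gamma> S(2) that] metrized_graph_wf(3)[OF \<Gamma> that]
      vertex_tau_interval_graph[of "cuts \<Gamma> S e" 0 "len \<Gamma> e"] by (simp_all add: distortion_interval_graph)
  show ?thesis
    unfolding replacement.vertex_tau_H[OF replacement_subdivide[OF \<Gamma> S] y] by (simp add: tau_i)
qed

text \<open>On a path \<open>share\<close> is the relative parameter, so
  \<open>resistance_new_new\<close> multiplies the deficit of the whole edge by the square of the
  fraction covered.\<close>

lemma subdivide_edge_deficit:
  assumes \<Gamma>: "metrized_graph \<Gamma>" and S: "finite S" "S \<subseteq> points \<Gamma>"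
    and e: "e \<in> edges \<Gamma>" and st: "(s, t) \<in> consec (cuts \<Gamma> S e)"
  shows "(t - s) - vertex_resistance (subdivide \<Gamma> S) (edge_point \<Gamma> e s) (edge_point \<Gamma> e t) =
    ((t - s) / len \<Gamma> e)\<^sup>2 * (len \<Gamma> e - vertex_resistance \<Gamma> (src \<Gamma> e) (tgt \<Gamma> e))"
proof -
  note D = consecD[OF st]
  have "0 \<le> s" "s \<le> len \<Gamma> e" "0 \<le> t" "t \<le> len \<Gamma> e"
    using D cuts_subset[OF \<Gamma> S(2) e] by auto
  then show ?thesis
    using replacement.resistance_new_new[OF replacement_subdivide[OF \<Gamma> S] e, of s t] S D
      metrized_graph_wf(3)[OF \<Gamma> e]
    by (simp add: resistance_interval_graph share_interval_graph diff_divide_distrib)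
qed

text \<open>\<open>resistance\<close> cuts the graph only at its two arguments. Comparing different
  cut sets requires that refining a graph already cut is again a replacement by paths, with one path
  per segment.\<close>

lemma replacement_subdivide_refine:
  fixes \<Gamma> :: "('v, 'e) mgraph"
  assumes \<Gamma>: "metrized_graph \<Gamma>" and S': "finite S'" "S' \<subseteq> points \<Gamma>" and SS': "S \<subseteq> S'"
  shows "replacement (subdivide \<Gamma> S) (\<lambda>(e, s, t). interval_graph (cuts \<Gamma> S' e \<inter> {s..t}))
    (subdivide \<Gamma> S') (\<lambda>(e, s, t). s) (\<lambda>(e, s, t). t) id (\<lambda>(e, s, t). edge_point \<Gamma> e)
    (\<lambda>(e, s, t). Pair e)"
proof
  have S: "finite S" "S \<subseteq> points \<Gamma>"
    using S' SS' finite_subset by auto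
  show "metrized_graph (subdivide \<Gamma> S)"
    using metrized_subdivide[OF \<Gamma> S] .
  have sub: "s \<in> cuts \<Gamma> S' e" "t \<in> cuts \<Gamma> S' e" "s < t" if "(s, t) \<in> consec (cuts \<Gamma> S e)" for e s t
    using consecD[OF that] cuts_mono[OF SS'] by auto
  fix x assume x: "x \<in> edges (subdivide \<Gamma> S)"
  then obtain e s t where est: "x = (e, s, t)" "e \<in> edges \<Gamma>" "(s, t) \<in> consec (cuts \<Gamma> S e)"
    by auto
  note sub' = sub[OF est(3)]
  have fin: "finite (cuts \<Gamma> S' e \<inter> {s..t})"
    using S' by simp
  show "metrized_graph (case x of (e, s, t) \<Rightarrow> interval_graph (cuts \<Gamma> S' e \<inter> {s..t}))"
    using fin sub' by (simp add: est(1)) (rule metrized_interval_graph, auto)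
  show "vertex_resistance (case x of (e, s, t) \<Rightarrow> interval_graph (cuts \<Gamma> S' e \<inter> {s..t}))
     (case x of (e, s, t) \<Rightarrow> t) (case x of (e, s, t) \<Rightarrow> s) = len (subdivide \<Gamma> S) x"
    using fin sub' by (simp add: est(1) resistance_interval_graph)
  show "(case x of (e, s, t) \<Rightarrow> s) \<in> nodes (case x of (e, s, t) \<Rightarrow> interval_graph (cuts \<Gamma> S' e \<inter> {s..t}))"
    "(case x of (e, s, t) \<Rightarrow> t) \<in> nodes (case x of (e, s, t) \<Rightarrow> interval_graph (cuts \<Gamma> S' e \<inter> {s..t}))"
    using sub' by (simp_all add: est(1))
next
  have S: "finite S" "S \<subseteq> points \<Gamma>"
    using S' SS' finite_subset by auto
  show "nodes (subdivide \<Gamma> S') = id ` nodes (subdivide \<Gamma> S) \<union> (\<Union>x \<in> edges (subdivide \<Gamma> S).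
      (case x of (e, s, t) \<Rightarrow> edge_point \<Gamma> e) `
        nodes (case x of (e, s, t) \<Rightarrow> interval_graph (cuts \<Gamma> S' e \<inter> {s..t})))" (is "?l = ?r")
  proof (rule equalityI; rule subsetI)
    fix x assume "x \<in> ?r"
    then show "x \<in> ?l"
    proof
      assume "x \<in> (\<Union>x \<in> edges (subdivide \<Gamma> S). (case x of (e, s, t) \<Rightarrow> edge_point \<Gamma> e) `
        nodes (case x of (e, s, t) \<Rightarrow> interval_graph (cuts \<Gamma> S' e \<inter> {s..t})))"
      then obtain e u where "e \<in> edges \<Gamma>" "u \<in> cuts \<Gamma> S' e" "x = edge_point \<Gamma> e u"
        by auto
      then show ?thesis
        using edge_point_in_nodes[OF \<Gamma>] by blast
    qed (use SS' in auto)
  next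
    fix x assume x: "x \<in> ?l"
    show "x \<in> ?r"
    proof (cases x)
      case (Inner e u)
      then have "x \<in> S'"
        using x by auto
      then have e: "e \<in> edges \<Gamma>" and u: "0 < u" "u < len \<Gamma> e" "u \<in> cuts \<Gamma> S' e"
        using S' Inner by (auto simp: points_def cuts_def)
      obtain s t where st: "(s, t) \<in> consec (cuts \<Gamma> S e)" "s \<le> u" "u < t"
        using consec_cover[of "cuts \<Gamma> S e" 0 "len \<Gamma> e" u] S u by auto
      have "x = edge_point \<Gamma> e u"
        using u by (simp add: Inner edge_point_def)
      then have "x \<in> (case (e, s, t) of (e, s, t) \<Rightarrow> edge_point \<Gamma> e) `
          nodes (case (e, s, t) of (e, s, t) \<Rightarrow> interval_graph (cuts \<Gamma> S' e \<inter> {s..t}))"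
        using st u by simp
      moreover have "(e, s, t) \<in> edges (subdivide \<Gamma> S)"
        using e st by simp
      ultimately show ?thesis by blast
    qed (use x S' in \<open>auto simp: points_def\<close>)
  qed
next
  have S: "finite S" "S \<subseteq> points \<Gamma>"
    using S' SS' finite_subset by auto
  let ?A = "SIGMA x : edges (subdivide \<Gamma> S).
      edges (case x of (e, s, t) \<Rightarrow> interval_graph (cuts \<Gamma> S' e \<inter> {s..t}))"
  let ?k = "\<lambda>(x, a). (case x of (e, s, t) \<Rightarrow> Pair e) a"
  note refine = consec_refine_iff[OF cuts_mono[OF SS']]
  show "bij_betw ?k ?A (edges (subdivide \<Gamma> S'))"
    unfolding bij_betw_def
  proof
    show "inj_on ?k ?A"
    proof (rule inj_onI)
      fix x y assume x: "x \<in> ?A" and y: "y \<in> ?A" and xy: "?k x = ?k y"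
      obtain e s t u v where x': "x = ((e, s, t), u, v)"
        by (metis prod.exhaust)
      obtain e' s' t' u' v' where y': "y = ((e', s', t'), u', v')"
        by (metis prod.exhaust)
      have eq: "e' = e" "u' = u" "v' = v"
        using xy x' y' by auto
      \<comment> \<open>The map forgets the segment, but the left end \<open>u\<close> of the finer
        gap determines it.\<close>
      have "(s, t) \<in> consec (cuts \<Gamma> S e)" "s \<le> u" "u < t"
        "(s', t') \<in> consec (cuts \<Gamma> S e)" "s' \<le> u" "u < t'"
        using x y refine unfolding x' y' eq by auto
      from consec_unique[OF this] show "x = y"
        by (simp add: x' y' eq)
    qed
    show "?k ` ?A = edges (subdivide \<Gamma> S')"
    proof (rule equalityI; rule subsetI)
      fix x assume "x \<in> ?k ` ?A"
      then show "x \<in> edges (subdivide \<Gamma> S')"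
        using refine by auto
    next
      fix x assume "x \<in> edges (subdivide \<Gamma> S')"
      then obtain e u v where x: "x = (e, u, v)" and e: "e \<in> edges \<Gamma>" and uv: "(u, v) \<in> consec (cuts \<Gamma> S' e)"
        by auto
      have "0 \<le> u" "u < len \<Gamma> e"
        using consecD[OF uv] cuts_subset[OF \<Gamma> S'(2) e] by force+
      then obtain s t where st: "(s, t) \<in> consec (cuts \<Gamma> S e)" "s \<le> u" "u < t"
        using consec_cover[of "cuts \<Gamma> S e" 0 "len \<Gamma> e" u] S by auto
      then have "((e, s, t), u, v) \<in> ?A"
        using e uv refine[OF st(1)] by simp
      moreover have "x = ?k ((e, s, t), u, v)"
        by (simp add: x)
      ultimately show "x \<in> ?k ` ?A"
        by blast
    qed
  qed
next
  fix f :: "('v, 'e) mpoint \<Rightarrow> real" and h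
  assume h1: "\<And>x. x \<in> edges (subdivide \<Gamma> S) \<Longrightarrow> h x (case x of (e, s, t) \<Rightarrow> s) = f (src (subdivide \<Gamma> S) x)"
    and h2: "\<And>x. x \<in> edges (subdivide \<Gamma> S) \<Longrightarrow> h x (case x of (e, s, t) \<Rightarrow> t) = f (tgt (subdivide \<Gamma> S) x)"
  \<comment> \<open>A point carries its edge and its parameter but not its segment, which
    \<open>seg\<close> recovers.\<close>
  define seg where "seg e u = (SOME p. p \<in> consec (cuts \<Gamma> S e) \<and> fst p \<le> u \<and> u < snd p)" for e u
  have seg: "seg e u = (s, t)" if "(s, t) \<in> consec (cuts \<Gamma> S e)" "s \<le> u" "u < t" for e u s t
    unfolding seg_def
  proof (rule some_equality)
    fix p assume "p \<in> consec (cuts \<Gamma> S e) \<and> fst p \<le> u \<and> u < snd p"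
    then show "p = (s, t)"
      using consec_unique[OF that, of "fst p" "snd p"] by (cases p) auto
  qed (use that in auto)
  \<comment> \<open>Ends of segments are served by \<open>f\<close>, which agrees with
    \<open>h\<close> there; 0 is a filler for labels that are no vertices.\<close>
  define F where "F x = (if x \<in> nodes (subdivide \<Gamma> S) then f x else
      case x of Vertex v \<Rightarrow> 0 | Inner e u \<Rightarrow> h (e, seg e u) u)" for x
  have F_edge: "F (edge_point \<Gamma> e w) = h (e, s, t) w"
    if e: "e \<in> edges \<Gamma>" and st: "(s, t) \<in> consec (cuts \<Gamma> S e)" and w: "s \<le> w" "w \<le> t" for e s t w
  proof -
    have x: "(e, s, t) \<in> edges (subdivide \<Gamma> S)"
      using e st by simp
    have S: "S \<subseteq> points \<Gamma>"
      using S' SS' by auto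
    note D = consecD[OF st]
    consider "w = s" | "w = t" | "s < w" "w < t"
      using w by linarith
    then show ?thesis
    proof cases
      case 3
      have "0 \<le> s" "t \<le> len \<Gamma> e"
        using D cuts_subset[OF \<Gamma> S e] by auto
      then have "edge_point \<Gamma> e w = Inner e w"
        using 3 by (simp add: edge_point_def)
      moreover have "Inner e w \<notin> S"
        using 3 consec_disjoint[OF st, of w] by (auto simp: cuts_def)
      ultimately show ?thesis
        using seg[OF st] 3 by (simp add: F_def image_iff)
    qed (use h1[OF x] h2[OF x] edge_point_in_nodes[OF \<Gamma> e, of _ S] D in \<open>simp_all add: F_def\<close>)
  qed
  show "\<exists>F. (\<forall>v \<in> nodes (subdivide \<Gamma> S). F (id v) = f v) \<and> (\<forall>x \<in> edges (subdivide \<Gamma> S).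
      \<forall>w \<in> nodes (case x of (e, s, t) \<Rightarrow> interval_graph (cuts \<Gamma> S' e \<inter> {s..t})).
      F ((case x of (e, s, t) \<Rightarrow> edge_point \<Gamma> e) w) = h x w)"
  proof (intro exI[of _ F] conjI ballI)
    show "F (id v) = f v" if "v \<in> nodes (subdivide \<Gamma> S)" for v
      unfolding F_def using that by simp
  qed (auto simp: F_edge)
qed (auto dest: consecD)

subsection \<open>The tau constant as a sum over edges\<close>

text \<open>\<open>A\<close> and \<open>B\<close> stand for the resistances from the ends of a
  segment to the base point, \<open>R\<close> for the one between the ends. The formula is required
  on the open interval only, because nothing is known about the derivative at the two ends and the
  integral ignores them.\<close>

lemma has_integral_square_deriv_quadratic:
  fixes r :: "real \<Rightarrow> real"
  assumes st: "s < t"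
    and r: "\<And>u. s < u \<Longrightarrow> u < t \<Longrightarrow> r u = (1 - (u - s) / (t - s)) * A + (u - s) / (t - s) * B
      - (u - s) / (t - s) * (1 - (u - s) / (t - s)) * R + (u - s) - ((u - s) / (t - s))\<^sup>2 * (t - s)"
  shows "((\<lambda>u. (deriv r u)\<^sup>2) has_integral (B - A)\<^sup>2 / (t - s) + (t - s - R)\<^sup>2 / (3 * (t - s))) {s..t}"
proof -
  define L where "L = t - s"
  \<comment> \<open>Centring at the midpoint makes the mixed term \<open>a * b\<close> drop out of
    the integral.\<close>
  define m where "m = (s + t) / 2"
  define a where "a = (B - A) / L"
  define b where "b = - 2 * (L - R) / L\<^sup>2"
  have L: "L > 0"
    using st by (simp add: L_def)
  define \<gamma> where "\<gamma> = (A + B) / 2 + (L - R) / 4"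
  have quad: "r u = \<gamma> + a * (u - m) + b / 2 * (u - m)\<^sup>2" if u: "s < u" "u < t" for u
  proof -
    define z where "z = (u - m) / L"
    have z: "u - m = z * L"
      using L by (simp add: z_def)
    have us: "u - s = (1 / 2 + z) * L"
      using z by (simp add: m_def L_def field_simps)
    have "r u = (1 - (1 / 2 + z)) * A + (1 / 2 + z) * B - (1 / 2 + z) * (1 - (1 / 2 + z)) * R
        + (1 / 2 + z) * L - (1 / 2 + z)\<^sup>2 * L"
      unfolding r[OF u] L_def[symmetric] us using L by simp
    also have "\<dots> = \<gamma> + (B - A) * z - (L - R) * z\<^sup>2"
      by (simp add: \<gamma>_def field_simps power2_eq_square)
    also have "\<dots> = \<gamma> + a * (z * L) + b / 2 * (z * L)\<^sup>2"
      using L by (simp add: a_def b_def power_mult_distrib) (simp add: algebra_simps)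
    finally show ?thesis
      by (simp add: z)
  qed
  have deriv: "deriv r u = a + b * (u - m)" if u: "s < u" "u < t" for u
  proof (rule DERIV_imp_deriv)
    have "((\<lambda>u. \<gamma> + a * (u - m) + b / 2 * (u - m)\<^sup>2) has_real_derivative a + b * (u - m)) (at u)"
      by (auto intro!: derivative_eq_intros)
    then show "(r has_real_derivative a + b * (u - m)) (at u)"
      by (rule has_field_derivative_transform_within_open[where S = "{s<..<t}"]) (use u quad in auto)
  qed
  define F where "F u = a\<^sup>2 * u + a * b * (u - m)\<^sup>2 + b\<^sup>2 / 3 * (u - m) ^ 3" for u
  have "((\<lambda>u. (a + b * (u - m))\<^sup>2) has_integral F t - F s) {s..t}"
  proof (rule fundamental_theorem_of_calculus)
    show "(F has_vector_derivative (a + b * (u - m))\<^sup>2) (at u within {s..t})" for u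
      unfolding F_def has_real_derivative_iff_has_vector_derivative [symmetric]
      by (auto intro!: derivative_eq_intros simp: power2_eq_square field_simps)
  qed (use st in simp)
  also have "F t - F s = a\<^sup>2 * L + b\<^sup>2 * L ^ 3 / 12"
  proof -
    have tm: "t - m = L / 2" and sm: "s - m = - (L / 2)"
      by (simp_all add: m_def L_def field_simps)
    have "F t - F s = a\<^sup>2 * (t - s) + b\<^sup>2 / 3 * (L / 2) ^ 3 + b\<^sup>2 / 3 * (L / 2) ^ 3"
      unfolding F_def tm sm by (simp add: algebra_simps)
    then show ?thesis
      by (simp add: L_def [symmetric] power_divide)
  qed
  also have "\<dots> = (B - A)\<^sup>2 / L + (L - R)\<^sup>2 / (3 * L)"
    using L by (simp add: a_def b_def power_divide power_mult_distrib power2_eq_square power3_eq_cube)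
      (simp add: field_simps)
  finally show ?thesis
    unfolding L_def
    by (rule has_integral_spike_finite[of "{s, t}", rotated 2]) (use deriv in auto)
qed

text \<open>The moving point is made a vertex in addition to \<open>S\<close>. The resulting graph
  refines both the one cut at the moving point and \<open>y\<close>, which defines the left side,
  and the one cut at \<open>S\<close>, whose fixed resistances express the right side.\<close>

lemma resistance_along_segment:
  assumes \<Gamma>: "metrized_graph \<Gamma>" and S: "finite S" "S \<subseteq> points \<Gamma>" and y: "y \<in> S"
    and e: "e \<in> edges \<Gamma>" and st: "(s, t) \<in> consec (cuts \<Gamma> S e)" and u: "s < u" "u < t"
  defines "r \<equiv> vertex_resistance (subdivide \<Gamma> S)" and "a \<equiv> edge_point \<Gamma> e s" and "b \<equiv> edge_point \<Gamma> e t"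
  shows "resistance \<Gamma> (edge_point \<Gamma> e u) y =
    (1 - (u - s) / (t - s)) * r a y + (u - s) / (t - s) * r b y
    - (u - s) / (t - s) * (1 - (u - s) / (t - s)) * r a b + (u - s) - ((u - s) / (t - s))\<^sup>2 * (t - s)"
proof -
  have "0 \<le> s" "t \<le> len \<Gamma> e"
    using consecD[OF st] cuts_subset[OF \<Gamma> S(2) e] by auto
  then have x: "edge_point \<Gamma> e u = Inner e u" "Inner e u \<in> points \<Gamma>"
    using u e by (auto simp: edge_point_def points_def)
  let ?x = "Inner e u" and ?S = "insert (Inner e u) S"
  let ?C = "cuts \<Gamma> ?S e \<inter> {s..t}"
  have S': "finite ?S" "?S \<subseteq> points \<Gamma>"
    using S x by auto
  have C: "finite ?C" "s \<in> ?C" "t \<in> ?C" "u \<in> ?C"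
    using finite_cuts[OF S'(1)] consecD[OF st] cuts_mono[of S ?S \<Gamma> e] u
    by (simp_all add: subset_eq) (simp add: cuts_def)
  have edge: "(e, s, t) \<in> edges (subdivide \<Gamma> S)"
    using e st by simp
  have "resistance \<Gamma> ?x y = vertex_resistance (subdivide \<Gamma> ?S) ?x y"
    using replacement.resistance_old_old[OF replacement_subdivide_refine[OF \<Gamma> S', of "{?x, y}"], of ?x y] y
    by (simp add: resistance_def)
  also have "\<dots> = (1 - share (interval_graph ?C) s t u) * r a y + share (interval_graph ?C) s t u * r b y
      - share (interval_graph ?C) s t u * (1 - share (interval_graph ?C) s t u) * r a b
      + vertex_resistance (interval_graph ?C) u s - (share (interval_graph ?C) s t u)\<^sup>2 * (t - s)"
    using replacement.resistance_new_old[OF replacement_subdivide_refine[OF \<Gamma> S', of S] edge, of u y] C y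
    by (simp add: x r_def a_def b_def subset_insertI)
  also have "share (interval_graph ?C) s t u = (u - s) / (t - s)"
    using C u by (intro share_interval_graph) auto
  also have "vertex_resistance (interval_graph ?C) u s = u - s"
    using resistance_interval_graph[OF C(1,4,2)] u by simp
  finally show ?thesis
    by (simp only: x)
qed

text \<open>Having \<open>y\<close> in \<open>S\<close> keeps it out of the interior of all
  segments, so \<open>r(., y)\<close> is one quadratic polynomial on each; the integral there is
  four times the summand of \<open>vertex_tau\<close>.\<close>

lemma tau_at_eq_vertex_tau:
  assumes \<Gamma>: "metrized_graph \<Gamma>" and S: "finite S" "S \<subseteq> points \<Gamma>" and y: "y \<in> S"
  shows "tau_at \<Gamma> y = vertex_tau (subdivide \<Gamma> S) y"
proof -
  let ?r = "vertex_resistance (subdivide \<Gamma> S)" and ?p = "edge_point \<Gamma>"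
  define I where "I e = (\<lambda>(s, t). (?r (?p e t) y - ?r (?p e s) y)\<^sup>2 / (t - s) +
     (t - s - ?r (?p e s) (?p e t))\<^sup>2 / (3 * (t - s)))" for e
  have "integral {0..len \<Gamma> e} (\<lambda>t. (deriv (\<lambda>s. resistance \<Gamma> (?p e s) y) t)\<^sup>2) =
      (\<Sum>p \<in> consec (cuts \<Gamma> S e). I e p)" if e: "e \<in> edges \<Gamma>" for e
  proof (rule integral_unique)
    let ?C = "cuts \<Gamma> S e" and ?F = "\<lambda>t. (deriv (\<lambda>s. resistance \<Gamma> (?p e s) y) t)\<^sup>2"
    have "(?F has_integral (\<Sum>p \<in> consec ?C. I e p)) {Min ?C..Max ?C}"
    proof (rule has_integral_consec)
      fix s t assume st: "(s, t) \<in> consec ?C"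
      show "(?F has_integral I e (s, t)) {s..t}"
        unfolding I_def prod.case
        by (rule has_integral_square_deriv_quadratic)
          (use consecD[OF st] resistance_along_segment[OF \<Gamma> S y e st] in auto)
    qed (use S in simp_all)
    also have "Min ?C = 0"
      using S cuts_subset[OF \<Gamma> S(2) e] by (intro Min_eqI) auto
    also have "Max ?C = len \<Gamma> e"
      using S cuts_subset[OF \<Gamma> S(2) e] by (intro Max_eqI) auto
    finally show "(?F has_integral (\<Sum>p \<in> consec ?C. I e p)) {0..len \<Gamma> e}" .
  qed
  then have "tau_at \<Gamma> y = 1 / 4 * (\<Sum>e \<in> edges \<Gamma>. \<Sum>p \<in> consec (cuts \<Gamma> S e). I e p)"
    by (simp add: tau_at_def)
  also have "\<dots> = (\<Sum>(e, p) \<in> edges (subdivide \<Gamma> S). 1 / 4 * I e p)"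
    using \<Gamma> S by (simp add: sum.Sigma sum_distrib_left case_prod_unfold)
  also have "\<dots> = vertex_tau (subdivide \<Gamma> S) y"
  proof -
    have alg: "1 / 4 * (x / d + w / (3 * d)) = x / (4 * d) + w / (12 * d)" for x w d :: real
      by (simp add: distrib_left)
    show ?thesis
      unfolding vertex_tau_def
    proof (rule sum.cong[OF refl])
      fix z assume "z \<in> edges (subdivide \<Gamma> S)"
      obtain e s t where z: "z = (e, s, t)"
        by (metis prod.exhaust)
      show "(case z of (e, p) \<Rightarrow> 1 / 4 * I e p) =
        (?r (tgt (subdivide \<Gamma> S) z) y - ?r (src (subdivide \<Gamma> S) z) y)\<^sup>2 / (4 * len (subdivide \<Gamma> S) z) +
        (len (subdivide \<Gamma> S) z - ?r (src (subdivide \<Gamma> S) z) (tgt (subdivide \<Gamma> S) z))\<^sup>2 /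
          (12 * len (subdivide \<Gamma> S) z)"
        unfolding z I_def prod.case subdivide_simps by (rule alg)
    qed
  qed
  finally show ?thesis .
qed

text \<open>The base point chosen in the definition may lie inside an edge. Once it is made a
  vertex, the base point can be moved to \<open>v\<close> and the cut undone.\<close>

lemma tau_eq_vertex_tau:
  assumes \<Gamma>: "metrized_graph \<Gamma>" and v: "v \<in> nodes \<Gamma>"
  shows "tau \<Gamma> = vertex_tau \<Gamma> v"
proof -
  define y where "y = (SOME y. y \<in> points \<Gamma>)"
  have "Vertex v \<in> points \<Gamma>"
    using v by (simp add: points_def)
  then have y: "y \<in> points \<Gamma>"
    unfolding y_def by (rule someI)
  let ?S = "{y, Vertex v}"
  have S: "finite ?S" "?S \<subseteq> points \<Gamma>"
    using y \<open>Vertex v \<in> points \<Gamma>\<close> by auto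
  have "tau \<Gamma> = vertex_tau (subdivide \<Gamma> ?S) y"
    unfolding tau_def y_def [symmetric] by (rule tau_at_eq_vertex_tau[OF \<Gamma> S]) simp
  also have "\<dots> = vertex_tau (subdivide \<Gamma> ?S) (Vertex v)"
    by (rule vertex_tau_base_point[OF metrized_subdivide[OF \<Gamma> S]]) auto
  also have "\<dots> = vertex_tau \<Gamma> v"
    by (rule vertex_tau_subdivide[OF \<Gamma> S v])
  finally show ?thesis .
qed

lemma tau_subdivide:
  assumes "metrized_graph \<Gamma>" "finite S" "S \<subseteq> points \<Gamma>"
  shows "tau (subdivide \<Gamma> S) = tau \<Gamma>"
proof -
  obtain v where v: "v \<in> nodes \<Gamma>"
    using metrized_graph_nonempty[OF assms(1)] by blast
  then show ?thesis
    using tau_eq_vertex_tau[OF assms(1) v] vertex_tau_subdivide[OF assms v]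
      tau_eq_vertex_tau[OF metrized_subdivide[OF assms], of "Vertex v"] by simp
qed

lemma total_length_subdivide:
  assumes \<Gamma>: "metrized_graph \<Gamma>" and S: "finite S" "S \<subseteq> points \<Gamma>"
  shows "total_length (subdivide \<Gamma> S) = total_length \<Gamma>"
    and "e \<in> edges \<Gamma> \<Longrightarrow> (\<Sum>(s, t) \<in> consec (cuts \<Gamma> S e). t - s) = len \<Gamma> e"
proof -
  show *: "(\<Sum>(s, t) \<in> consec (cuts \<Gamma> S e). t - s) = len \<Gamma> e" if e: "e \<in> edges \<Gamma>" for e
  proof -
    let ?C = "cuts \<Gamma> S e"
    have "Min ?C = 0"
      using S cuts_subset[OF \<Gamma> S(2) e] by (intro Min_eqI) auto
    moreover have "Max ?C = len \<Gamma> e"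
      using S cuts_subset[OF \<Gamma> S(2) e] by (intro Max_eqI) auto
    moreover have "?C \<noteq> {}"
      by (simp add: cuts_def)
    ultimately show ?thesis
      using sum_consec[of ?C "\<lambda>x. x"] S by simp
  qed
  have "total_length (subdivide \<Gamma> S) = (\<Sum>e \<in> edges \<Gamma>. \<Sum>(s, t) \<in> consec (cuts \<Gamma> S e). t - s)"
    unfolding total_length_def using \<Gamma> S
    by (simp add: sum.Sigma) (rule sum.cong, auto)
  then show "total_length (subdivide \<Gamma> S) = total_length \<Gamma>"
    unfolding total_length_def using * by simp
qed

subsection \<open>Star products\<close>

definition scale :: "real \<Rightarrow> ('v, 'e) mgraph \<Rightarrow> ('v, 'e) mgraph" where
  "scale \<mu> G = G\<lparr>len := \<lambda>e. \<mu> * len G e\<rparr>"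

lemma scale_simps [simp]: "skeleton (scale \<mu> G) = skeleton G" "len (scale \<mu> G) e = \<mu> * len G e"
  by (simp_all add: scale_def)

lemma metrized_scale: "metrized_graph G \<Longrightarrow> 0 < \<mu> \<Longrightarrow> metrized_graph (scale \<mu> G)"
  by (simp add: metrized_graph_def)

lemma resistance_scale:
  assumes G: "metrized_graph G" and l: "0 < \<mu>" and xy: "x \<in> nodes G" "y \<in> nodes G"
  shows "vertex_resistance (scale \<mu> G) x y = \<mu> * vertex_resistance G x y"
proof -
  obtain f where f: "potential G x y f"
    using potential_exists[OF G xy] by blast
  have "energy (scale \<mu> G) h g = energy G h g / \<mu>" for h g
    by (simp add: energy_def sum_divide_distrib mult.commute)
  then have "potential (scale \<mu> G) x y (\<lambda>v. \<mu> * f v)"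
    using l f by (simp add: potential_def energy_scale)
  from vertex_resistance_eq[OF metrized_scale[OF G l] _ _ this] show ?thesis
    using vertex_resistance_eq[OF G xy f] xy by (simp add: right_diff_distrib)
qed

lemma vertex_tau_scale:
  assumes G: "metrized_graph G" and l: "0 < \<mu>" and y: "y \<in> nodes G"
  shows "vertex_tau (scale \<mu> G) y = \<mu> * vertex_tau G y"
proof -
  have alg: "(\<mu> * a - \<mu> * b)\<^sup>2 / (4 * (\<mu> * L)) + (\<mu> * L - \<mu> * c)\<^sup>2 / (12 * (\<mu> * L)) =
      \<mu> * ((a - b)\<^sup>2 / (4 * L) + (L - c)\<^sup>2 / (12 * L))" for a b c L
    unfolding right_diff_distrib [symmetric] power_mult_distrib
    using l by (simp add: power2_eq_square distrib_left)
  show ?thesis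
    unfolding vertex_tau_def sum_distrib_left
    by (rule sum.cong) (use G l y alg in \<open>simp_all add: resistance_scale\<close>)
qed

lemma share_scale:
  assumes "metrized_graph G" "0 < \<mu>" "p \<in> nodes G" "q \<in> nodes G" "w \<in> nodes G"
  shows "share (scale \<mu> G) p q w = share G p q w"
  using assms by (simp add: share_def resistance_scale distrib_left [symmetric] right_diff_distrib [symmetric])

lemma distortion_scale:
  assumes G: "metrized_graph G" and l: "0 < \<mu>" and pq: "p \<in> nodes G" "q \<in> nodes G"
  shows "distortion (scale \<mu> G) p q = distortion G p q"
proof -
  have X: "residual (scale \<mu> G) p q w = \<mu> * residual G p q w" if "w \<in> nodes G" for w
    using G l pq that by (simp add: residual_def share_scale resistance_scale algebra_simps)
  have alg: "((\<mu> * L - \<mu> * r) * d - 3 * (\<mu> * x - \<mu> * x') * d') / (6 * (\<mu> * L)) =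
      ((L - r) * d - 3 * (x - x') * d') / (6 * L)" for L r d x x' d'
  proof -
    have "(\<mu> * L - \<mu> * r) * d - 3 * (\<mu> * x - \<mu> * x') * d' = \<mu> * ((L - r) * d - 3 * (x - x') * d')"
      by (simp add: algebra_simps)
    then show ?thesis
      using l by simp
  qed
  show ?thesis
    unfolding distortion_def Let_def scale_simps
  proof (rule sum.cong[OF refl])
    fix e assume e: "e \<in> edges G"
    note ab = metrized_graph_wf(1,2)[OF G e]
    show "((\<mu> * len G e - vertex_resistance (scale \<mu> G) (src G e) (tgt G e)) *
        (share (scale \<mu> G) p q (tgt G e) - share (scale \<mu> G) p q (src G e))\<^sup>2 -
        3 * (residual (scale \<mu> G) p q (tgt G e) - residual (scale \<mu> G) p q (src G e)) *
        ((share (scale \<mu> G) p q (tgt G e))\<^sup>2 - (share (scale \<mu> G) p q (src G e))\<^sup>2)) /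
        (6 * (\<mu> * len G e)) =
      ((len G e - vertex_resistance G (src G e) (tgt G e)) *
        (share G p q (tgt G e) - share G p q (src G e))\<^sup>2 -
        3 * (residual G p q (tgt G e) - residual G p q (src G e)) *
        ((share G p q (tgt G e))\<^sup>2 - (share G p q (src G e))\<^sup>2)) / (6 * len G e)"
      unfolding X[OF ab(1)] X[OF ab(2)] share_scale[OF G l pq ab(1)] share_scale[OF G l pq ab(2)]
        resistance_scale[OF G l ab] by (rule alg)
  qed
qed

text \<open>Scaling \<open>G\<close> by \<open>\<rho>\<close> and the copy of \<open>N\<close> for
  \<open>e\<close> by \<open>len G e\<close> gives both the edge length and the terminal resistance
  the value \<open>\<rho> * len G e\<close>, while total lengths multiply. Distinct terminals make
  \<open>\<rho>\<close> positive. The finite sets of vertices and edges are numbered to obtain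
  labels in \<open>nat\<close>.\<close>

lemma star_product:
  fixes G :: "('v, 'e) mgraph" and N :: "('w, 'f) mgraph"
  assumes G: "metrized_graph G" and N: "metrized_graph N" and pq: "p \<in> nodes N" "q \<in> nodes N" "p \<noteq> q"
    and y: "y \<in> nodes G"
  defines "\<rho> \<equiv> vertex_resistance N q p"
  obtains H :: "(nat, nat) mgraph" where "metrized_graph H"
    "total_length H = total_length G * total_length N"
    "tau H = \<rho> * vertex_tau G y + total_length G * (vertex_tau N p - \<rho> / 4) +
       \<rho> * distortion N p q * (\<Sum>e \<in> edges G. len G e - vertex_resistance G (src G e) (tgt G e))"
proof -
  have \<rho>: "\<rho> > 0"
    unfolding \<rho>_def using vertex_resistance_pos[OF N pq(2,1)] pq(3) by simp
  have len: "len G e > 0" if "e \<in> edges G" for e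
    using metrized_graph_wf(3)[OF G that] .
  let ?G = "scale \<rho> G" and ?N = "\<lambda>e. scale (len G e) N"
  \<comment> \<open>The terminals become the old ends, even if \<open>e\<close> is a loop and these
    coincide; other vertices are tagged with \<open>e\<close>, so copies meet only in old
    vertices.\<close>
  define i :: "'e \<Rightarrow> 'w \<Rightarrow> 'v + 'e \<times> 'w" where
    "i e w = (if w = p then Inl (src G e) else if w = q then Inl (tgt G e) else Inr (e, w))" for e w
  define V where "V = Inl ` nodes G \<union> (\<Union>e \<in> edges G. i e ` nodes N)"
  define A where "A = edges G \<times> edges N"
  define H :: "(nat, nat) mgraph" where "H =
    \<lparr>skeleton = \<lparr>verts = to_nat_on V ` V, arcs = to_nat_on A ` A,
       tail = (\<lambda>n. case from_nat_into A n of (e, a) \<Rightarrow> to_nat_on V (i e (src N a))),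
       head = (\<lambda>n. case from_nat_into A n of (e, a) \<Rightarrow> to_nat_on V (i e (tgt N a)))\<rparr>,
     len = (\<lambda>n. case from_nat_into A n of (e, a) \<Rightarrow> len G e * len N a)\<rparr>"
  have "finite V" "finite A"
    using G N by (auto simp: V_def A_def)
  then have c: "countable V" "countable A"
    by (auto intro: countable_finite)
  note injA = inj_on_to_nat_on[OF c(2)]
  interpret R: replacement ?G ?N H "\<lambda>_. p" "\<lambda>_. q" "\<lambda>v. to_nat_on V (Inl v)" "\<lambda>e w. to_nat_on V (i e w)"
    "\<lambda>e a. to_nat_on A (e, a)"
  proof
    show "metrized_graph ?G"
      using metrized_scale[OF G \<rho>] .
    fix e assume e: "e \<in> edges ?G"
    show "metrized_graph (?N e)"
      using metrized_scale[OF N len] e by simp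
    show "vertex_resistance (?N e) q p = len ?G e"
      using resistance_scale[OF N len pq(2,1)] e by (simp add: \<rho>_def)
  next
    show "nodes H = (\<lambda>v. to_nat_on V (Inl v)) ` nodes ?G \<union>
        (\<Union>e \<in> edges ?G. (\<lambda>w. to_nat_on V (i e w)) ` nodes (?N e))"
      by (simp add: H_def V_def image_Un image_UN image_image)
  next
    show "bij_betw (\<lambda>(e, a). to_nat_on A (e, a)) (SIGMA e : edges ?G. edges (?N e)) (edges H)"
      using inj_on_imp_bij_betw[OF injA] by (simp add: H_def A_def)
  next
    fix f :: "'v \<Rightarrow> real" and h
    assume h: "\<And>e. e \<in> edges ?G \<Longrightarrow> h e p = f (src ?G e)" "\<And>e. e \<in> edges ?G \<Longrightarrow> h e q = f (tgt ?G e)"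
    define F where "F n = (case from_nat_into V n of Inl v \<Rightarrow> f v | Inr (e, w) \<Rightarrow> h e w)" for n
    have "F (to_nat_on V (Inl v)) = f v" if "v \<in> nodes G" for v
      using that c by (simp add: F_def V_def)
    moreover have "F (to_nat_on V (i e w)) = h e w" if e: "e \<in> edges G" and w: "w \<in> nodes N" for e w
    proof -
      have "i e w \<in> V"
        using e w by (auto simp: V_def)
      then have "F (to_nat_on V (i e w)) = (case i e w of Inl v \<Rightarrow> f v | Inr (e, w) \<Rightarrow> h e w)"
        using c by (simp add: F_def)
      then show ?thesis
        using h e by (simp add: i_def)
    qed
    ultimately show "\<exists>F. (\<forall>v \<in> nodes ?G. F (to_nat_on V (Inl v)) = f v) \<and>
        (\<forall>e \<in> edges ?G. \<forall>w \<in> nodes (?N e). F (to_nat_on V (i e w)) = h e w)"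
      by (intro exI[of _ F]) simp
  qed (use pq c in \<open>simp_all add: i_def H_def A_def\<close>)
  have "total_length H = (\<Sum>e \<in> edges G. \<Sum>a \<in> edges N. len G e * len N a)"
    unfolding total_length_def R.sum_edges_H by (simp add: R.len_H)
  then have 1: "total_length H = total_length G * total_length N"
    by (simp add: total_length_def sum_product)
  have "tau H = vertex_tau H (to_nat_on V (Inl y))"
    using y by (intro tau_eq_vertex_tau R.metrized_H R.j_in_nodes_H) simp
  also have "\<dots> = vertex_tau ?G y + (\<Sum>e \<in> edges G. vertex_tau (?N e) p - \<rho> * len G e / 4 +
      (\<rho> * len G e - vertex_resistance ?G (src G e) (tgt G e)) * distortion (?N e) p q)"
    using R.vertex_tau_H[of y] y by simp
  also have "vertex_tau ?G y = \<rho> * vertex_tau G y"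
    using vertex_tau_scale[OF G \<rho> y] .
  also have "(\<Sum>e \<in> edges G. vertex_tau (?N e) p - \<rho> * len G e / 4 +
      (\<rho> * len G e - vertex_resistance ?G (src G e) (tgt G e)) * distortion (?N e) p q) =
    (\<Sum>e \<in> edges G. len G e * (vertex_tau N p - \<rho> / 4) +
      \<rho> * distortion N p q * (len G e - vertex_resistance G (src G e) (tgt G e)))"
    by (rule sum.cong[OF refl])
      (use G N \<rho> len pq in \<open>simp add: vertex_tau_scale resistance_scale distortion_scale algebra_simps\<close>)
  also have "\<dots> = total_length G * (vertex_tau N p - \<rho> / 4) + \<rho> * distortion N p q *
      (\<Sum>e \<in> edges G. len G e - vertex_resistance G (src G e) (tgt G e))"
    by (simp add: sum.distrib total_length_def sum_distrib_left sum_distrib_right)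
  finally have 2: "tau H = \<rho> * vertex_tau G y + total_length G * (vertex_tau N p - \<rho> / 4) +
       \<rho> * distortion N p q * (\<Sum>e \<in> edges G. len G e - vertex_resistance G (src G e) (tgt G e))"
    by simp
  show thesis
    using that[OF R.metrized_H 1 2] .
qed

section \<open>Cutting every edge into equal pieces\<close>

definition grid :: "('v, 'e) mgraph \<Rightarrow> nat \<Rightarrow> ('v, 'e) mpoint set" where
  "grid \<Gamma> n = (\<lambda>(e, k). Inner e (real k / real n * len \<Gamma> e)) ` (edges \<Gamma> \<times> {0<..<n})"

lemma grid:
  assumes \<Gamma>: "metrized_graph \<Gamma>"
  shows "finite (grid \<Gamma> n)" "grid \<Gamma> n \<subseteq> points \<Gamma>"
proof -
  show "finite (grid \<Gamma> n)"
    using \<Gamma> by (simp add: grid_def)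
  have "real k / real n * len \<Gamma> e < len \<Gamma> e" "0 < real k / real n * len \<Gamma> e"
    if "e \<in> edges \<Gamma>" "0 < k" "k < n" for e k
    using metrized_graph_wf(3)[OF \<Gamma> that(1)] that by (auto simp: divide_simps)
  then show "grid \<Gamma> n \<subseteq> points \<Gamma>"
    by (auto simp: grid_def points_def)
qed

lemma cuts_grid:
  assumes "0 < n" "e \<in> edges \<Gamma>"
  shows "cuts \<Gamma> (grid \<Gamma> n) e = (\<lambda>k. real k / real n * len \<Gamma> e) ` {0..n}"
proof -
  have "{0..n} = insert 0 (insert n {0<..<n})"
    using assms by auto
  then show ?thesis
    using assms by (auto simp: cuts_def grid_def)
qed

lemma consec_grid:
  assumes \<Gamma>: "metrized_graph \<Gamma>" and n: "0 < n" and e: "e \<in> edges \<Gamma>"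
    and st: "(s, t) \<in> consec (cuts \<Gamma> (grid \<Gamma> n) e)"
  shows "t - s \<le> len \<Gamma> e / real n"
proof -
  note cg = cuts_grid[OF n e]
  have L: "0 < len \<Gamma> e"
    using metrized_graph_wf(3)[OF \<Gamma> e] .
  obtain k l where k: "s = real k / real n * len \<Gamma> e" and l: "l \<le> n" "t = real l / real n * len \<Gamma> e"
    using consecD[OF st] unfolding cg by (blast dest: atLeastAtMost_iff [THEN iffD1])
  have "k < l"
    using consecD[OF st] L n by (simp add: k l divide_simps mult_less_cancel_right)
  let ?u = "real (Suc k) / real n * len \<Gamma> e"
  have "?u \<in> cuts \<Gamma> (grid \<Gamma> n) e"
    unfolding cg using \<open>k < l\<close> l by (intro imageI) simp
  moreover have "s < ?u"
    using L n by (simp add: k divide_simps)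
  ultimately have "t \<le> ?u"
    using consec_disjoint[OF st] by fastforce
  also have "?u = s + len \<Gamma> e / real n"
    using n by (simp add: k field_simps)
  finally show ?thesis by simp
qed

text \<open>The deficit of a piece carries the square of its relative length; one factor is at most
  \<open>1 / n\<close>, the other sums to 1 over the edge.\<close>

lemma grid_deficit:
  assumes \<Gamma>: "metrized_graph \<Gamma>" and n: "0 < n"
  defines "G \<equiv> subdivide \<Gamma> (grid \<Gamma> n)"
  shows "\<bar>\<Sum>x \<in> edges G. len G x - vertex_resistance G (src G x) (tgt G x)\<bar> \<le>
    (\<Sum>e \<in> edges \<Gamma>. \<bar>len \<Gamma> e - vertex_resistance \<Gamma> (src \<Gamma> e) (tgt \<Gamma> e)\<bar>) / real n"
proof -
  let ?m = "\<lambda>e. len \<Gamma> e - vertex_resistance \<Gamma> (src \<Gamma> e) (tgt \<Gamma> e)"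
  let ?C = "cuts \<Gamma> (grid \<Gamma> n)"
  note S = grid[OF \<Gamma>, of n]
  have "(\<Sum>x \<in> edges G. len G x - vertex_resistance G (src G x) (tgt G x)) =
      (\<Sum>(e, s, t) \<in> edges G. ((t - s) / len \<Gamma> e)\<^sup>2 * ?m e)"
    by (rule sum.cong[OF refl]) (use subdivide_edge_deficit[OF \<Gamma> S] in \<open>auto simp: G_def\<close>)
  also have "\<dots> = (\<Sum>e \<in> edges \<Gamma>. \<Sum>(s, t) \<in> consec (?C e). ((t - s) / len \<Gamma> e)\<^sup>2 * ?m e)"
    using \<Gamma> S by (simp add: G_def sum.Sigma)
  also have "\<bar>\<dots>\<bar> \<le> (\<Sum>e \<in> edges \<Gamma>. \<bar>\<Sum>(s, t) \<in> consec (?C e). ((t - s) / len \<Gamma> e)\<^sup>2 * ?m e\<bar>)"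
    by (rule sum_abs)
  also have "\<dots> \<le> (\<Sum>e \<in> edges \<Gamma>. \<bar>?m e\<bar> / real n)"
  proof (rule sum_mono)
    fix e assume e: "e \<in> edges \<Gamma>"
    have L: "0 < len \<Gamma> e"
      using metrized_graph_wf(3)[OF \<Gamma> e] .
    have "\<bar>\<Sum>(s, t) \<in> consec (?C e). ((t - s) / len \<Gamma> e)\<^sup>2 * ?m e\<bar> \<le>
        (\<Sum>(s, t) \<in> consec (?C e). \<bar>((t - s) / len \<Gamma> e)\<^sup>2 * ?m e\<bar>)"
      using sum_abs[of "\<lambda>(s, t). ((t - s) / len \<Gamma> e)\<^sup>2 * ?m e"] by (simp add: case_prod_unfold)
    also have "\<dots> \<le> (\<Sum>(s, t) \<in> consec (?C e). (t - s) * (\<bar>?m e\<bar> / (real n * len \<Gamma> e)))"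
    proof (rule sum_mono, clarify)
      fix s t assume st: "(s, t) \<in> consec (?C e)"
      have "(t - s) / len \<Gamma> e \<le> 1 / real n"
        using consec_grid[OF \<Gamma> n e st] L n by (simp add: field_simps)
      then have "((t - s) / len \<Gamma> e)\<^sup>2 \<le> (t - s) / len \<Gamma> e * (1 / real n)"
        unfolding power2_eq_square using consecD[OF st] L by (intro mult_left_mono) auto
      then have "((t - s) / len \<Gamma> e)\<^sup>2 * \<bar>?m e\<bar> \<le> (t - s) / len \<Gamma> e * (1 / real n) * \<bar>?m e\<bar>"
        by (rule mult_right_mono) simp
      then show "\<bar>((t - s) / len \<Gamma> e)\<^sup>2 * ?m e\<bar> \<le> (t - s) * (\<bar>?m e\<bar> / (real n * len \<Gamma> e))"
        by (simp add: abs_mult mult.commute)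
    qed
    also have "\<dots> = (\<Sum>(s, t) \<in> consec (?C e). t - s) * (\<bar>?m e\<bar> / (real n * len \<Gamma> e))"
      by (simp only: sum_distrib_right case_prod_unfold)
    also have "\<dots> = \<bar>?m e\<bar> / real n"
      unfolding total_length_subdivide(2)[OF \<Gamma> S e] using L by simp
    finally show "\<bar>\<Sum>(s, t) \<in> consec (?C e). ((t - s) / len \<Gamma> e)\<^sup>2 * ?m e\<bar> \<le> \<bar>?m e\<bar> / real n" .
  qed
  finally show ?thesis
    by (simp add: sum_divide_distrib)
qed

text \<open>\<open>\<Gamma>\<close> is the frame that gets cut, \<open>N\<close> the network
  inserted. Keeping them apart lets \<open>N\<close> have the terminals among its vertices and
  allows networks other than \<open>\<Gamma>\<close>.\<close>

lemma approximating_star_product: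
  fixes \<Gamma> :: "('v, 'e) mgraph" and N :: "('w, 'f) mgraph"
  assumes \<Gamma>: "metrized_graph \<Gamma>" "total_length \<Gamma> = 1" and N: "metrized_graph N" "total_length N = 1"
    and pq: "p \<in> nodes N" "q \<in> nodes N" "p \<noteq> q" and "0 < \<epsilon>"
  shows "\<exists>H :: (nat, nat) mgraph. metrized_graph H \<and> total_length H = 1 \<and>
    tau H \<le> tau N - vertex_resistance N p q * (1 / 4 - tau \<Gamma>) + \<epsilon>"
proof -
  let ?\<rho> = "vertex_resistance N q p"
  define K where "K = ?\<rho> * distortion N p q"
  define M where "M = (\<Sum>e \<in> edges \<Gamma>. \<bar>len \<Gamma> e - vertex_resistance \<Gamma> (src \<Gamma> e) (tgt \<Gamma> e)\<bar>)"
  \<comment> \<open>\<open>K\<close> may have either sign, hence the absolute value; the maximum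
    with 1 makes \<open>n\<close> positive.\<close>
  obtain n where n: "\<bar>K\<bar> * M / \<epsilon> < real n" "0 < n"
    using reals_Archimedean2[of "max 1 (\<bar>K\<bar> * M / \<epsilon>)"] by (metis max_less_iff_conj of_nat_0_less_iff
        less_trans zero_less_one)
  let ?G = "subdivide \<Gamma> (grid \<Gamma> n)"
  note S = grid[OF \<Gamma>(1), of n]
  note G = metrized_subdivide[OF \<Gamma>(1) S]
  obtain v where v: "v \<in> nodes \<Gamma>"
    using metrized_graph_nonempty[OF \<Gamma>(1)] by blast
  then have v': "Vertex v \<in> nodes ?G"
    by simp
  let ?d = "\<Sum>x \<in> edges ?G. len ?G x - vertex_resistance ?G (src ?G x) (tgt ?G x)"
  have len: "total_length ?G = 1"
    using total_length_subdivide(1)[OF \<Gamma>(1) S] \<Gamma>(2) by simp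
  obtain H :: "(nat, nat) mgraph" where H: "metrized_graph H" "total_length H = total_length ?G * total_length N"
    "tau H = ?\<rho> * vertex_tau ?G (Vertex v) + total_length ?G * (vertex_tau N p - ?\<rho> / 4) +
       ?\<rho> * distortion N p q * ?d"
    by (rule star_product[OF G N(1) pq v'])
  have "vertex_tau ?G (Vertex v) = tau \<Gamma>"
    using tau_eq_vertex_tau[OF G v'] tau_subdivide[OF \<Gamma>(1) S] by simp
  moreover have "vertex_tau N p = tau N"
    using tau_eq_vertex_tau[OF N(1) pq(1)] by simp
  moreover have "K * ?d \<le> \<epsilon>"
  proof -
    have "K * ?d \<le> \<bar>K\<bar> * \<bar>?d\<bar>"
      using abs_ge_self[of "K * ?d"] by (simp only: abs_mult)
    also have "\<dots> \<le> \<bar>K\<bar> * (M / real n)"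
      unfolding M_def by (rule mult_left_mono[OF grid_deficit[OF \<Gamma>(1) n(2)]]) simp
    also have "\<dots> \<le> \<epsilon>"
      using n \<open>0 < \<epsilon>\<close> by (simp add: field_simps)
    finally show ?thesis .
  qed
  ultimately have "tau H \<le> tau N - ?\<rho> * (1 / 4 - tau \<Gamma>) + \<epsilon>"
    using H(3) len by (simp add: K_def algebra_simps)
  moreover have "?\<rho> = vertex_resistance N p q"
    using vertex_resistance_sym[OF N(1) pq(1,2)] by simp
  ultimately show ?thesis
    using H(1,2) len N(2) by auto
qed

text \<open>For distinct points the inserted network is \<open>\<Gamma>\<close> with
  \<open>p\<close> and \<open>q\<close> made vertices, which changes neither its length nor its tau
  constant.\<close>

lemma tau_improvement:
  fixes \<Gamma> :: "('v, 'e) mgraph"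
  assumes \<Gamma>: "metrized_graph \<Gamma>" "total_length \<Gamma> = 1" and pq: "p \<in> points \<Gamma>" "q \<in> points \<Gamma>"
    and \<epsilon>: "0 < \<epsilon>"
  shows "\<exists>\<Gamma>' :: (nat, nat) mgraph. metrized_graph \<Gamma>' \<and> total_length \<Gamma>' = 1 \<and>
    tau \<Gamma>' \<le> tau \<Gamma> - resistance \<Gamma> p q * (1 / 4 - tau \<Gamma>) + \<epsilon>"
proof -
  let ?N = "subdivide \<Gamma> {p, q}"
  have S: "finite {p, q}" "{p, q} \<subseteq> points \<Gamma>"
    using pq by auto
  note N = metrized_subdivide[OF \<Gamma>(1) S]
  show ?thesis
  proof (cases "p = q")
    case False
    then show ?thesis
      using approximating_star_product[OF \<Gamma> N _ _ _ False \<epsilon>]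
        total_length_subdivide(1)[OF \<Gamma>(1) S] tau_subdivide[OF \<Gamma>(1) S] \<Gamma>(2)
      by (simp add: resistance_def)
  next
    case True
    \<comment> \<open>The star product with a single segment is a copy of \<open>\<Gamma>\<close> labelled by natural numbers.\<close>
    let ?I = "interval_graph {0, 1}"
    have I: "metrized_graph ?I"
      by (rule metrized_interval_graph) auto
    have c: "consec {0, 1} = {(0, 1)}"
      by (auto simp: consec_def)
    have len: "total_length ?I = 1"
      by (simp add: total_length_def c)
    have r: "vertex_resistance ?I 0 1 = 1"
      by (simp add: resistance_interval_graph)
    have t: "tau ?I = 1 / 4"
      using tau_eq_vertex_tau[OF I, of 0] vertex_tau_interval_graph[of "{0, 1}" 0 1] by simp
    have "resistance \<Gamma> p q = 0"
      using N True by (simp add: resistance_def)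
    \<comment> \<open>With resistance 1 and tau constant \<open>1 / 4\<close> of the segment, the
      bound becomes \<open>tau \<Gamma> + \<epsilon>\<close>.\<close>
    then show ?thesis
      using approximating_star_product[OF \<Gamma> I len _ _ _ \<epsilon>, of 0 1] by (simp add: r t)
  qed
qed

text \<open>A loop of length 1: its ends coincide, so the deficit is the whole length, whence
  \<open>1 / 12\<close>. The example serves to force an admissible \<open>C\<close> below
  \<open>1 / 4\<close>.\<close>

lemma circle:
  obtains G :: "(nat, nat) mgraph" where "metrized_graph G" "total_length G = 1" "tau G = 1 / 12"
proof -
  define G :: "(nat, nat) mgraph" where
    "G = \<lparr>skeleton = \<lparr>verts = {0}, arcs = {0}, tail = (\<lambda>_. 0), head = (\<lambda>_. 0)\<rparr>, len = (\<lambda>_. 1)\<rparr>"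
  have G: "metrized_graph G"
    by (rule metrized_graphI) (auto simp: G_def)
  have "vertex_resistance G 0 0 = 0"
    using vertex_resistance_self[OF G, of 0] by (simp add: G_def)
  then have "vertex_tau G 0 = 1 / 12"
    unfolding vertex_tau_def by (simp add: G_def)
  then show thesis
    using that[OF G] tau_eq_vertex_tau[OF G, of 0] by (simp add: G_def total_length_def)
qed

theorem theorem4p9:
  shows "(\<forall>(\<Gamma> :: ('v, 'e) mgraph) p q. \<forall>\<epsilon>>0.
            metrized_graph \<Gamma> \<and> total_length \<Gamma> = 1 \<and> p \<in> points \<Gamma> \<and> q \<in> points \<Gamma> \<longrightarrow>
            (\<exists>\<Gamma>' :: (nat, nat) mgraph. metrized_graph \<Gamma>' \<and> total_length \<Gamma>' = 1 \<and>
               tau \<Gamma>' \<le> tau \<Gamma> - resistance \<Gamma> p q * (1 / 4 - tau \<Gamma>) + \<epsilon>))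
       \<and> (\<forall>C>0.
            (\<forall>G :: (nat, nat) mgraph. metrized_graph G \<longrightarrow> tau G \<ge> C * total_length G) \<longrightarrow>
            \<not> (\<exists>\<beta> :: ('v, 'e) mgraph. metrized_graph \<beta> \<and> total_length \<beta> = 1 \<and> tau \<beta> = C))"
proof (intro conjI allI impI notI)
  fix \<Gamma> :: "('v, 'e) mgraph" and p q and \<epsilon> :: real
  assume "0 < \<epsilon>" "metrized_graph \<Gamma> \<and> total_length \<Gamma> = 1 \<and> p \<in> points \<Gamma> \<and> q \<in> points \<Gamma>"
  then show "\<exists>\<Gamma>' :: (nat, nat) mgraph. metrized_graph \<Gamma>' \<and> total_length \<Gamma>' = 1 \<and>
      tau \<Gamma>' \<le> tau \<Gamma> - resistance \<Gamma> p q * (1 / 4 - tau \<Gamma>) + \<epsilon>"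
    by (intro tau_improvement) auto
next
  fix C :: real
  assume C: "\<forall>G :: (nat, nat) mgraph. metrized_graph G \<longrightarrow> C * total_length G \<le> tau G"
  assume "\<exists>\<beta> :: ('v, 'e) mgraph. metrized_graph \<beta> \<and> total_length \<beta> = 1 \<and> tau \<beta> = C"
  then obtain \<beta> :: "('v, 'e) mgraph" where \<beta>: "metrized_graph \<beta>" "total_length \<beta> = 1" "tau \<beta> = C"
    by blast
  obtain G :: "(nat, nat) mgraph" where "metrized_graph G" "total_length G = 1" "tau G = 1 / 12"
    by (rule circle)
  with C have C4: "C < 1 / 4"
    by force
  have "edges \<beta> \<noteq> {}"
    using \<beta>(2) by (auto simp: total_length_def)
  then obtain e where e: "e \<in> edges \<beta>"
    by blast
  \<comment> \<open>Two distinct points are wanted; the tail and the midpoint of an edge differ even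
    on a loop.\<close>
  let ?p = "Vertex (src \<beta> e)" and ?q = "Inner e (len \<beta> e / 2)"
  have half: "0 < len \<beta> e / 2" "len \<beta> e / 2 < len \<beta> e"
    using metrized_graph_wf(3)[OF \<beta>(1) e] by linarith+
  have pq: "?p \<in> points \<beta>" "?q \<in> points \<beta>"
    using e metrized_graph_wf[OF \<beta>(1) e] half unfolding points_def by blast+
  have r: "0 < resistance \<beta> ?p ?q"
    unfolding resistance_def using pq by (intro vertex_resistance_pos metrized_subdivide[OF \<beta>(1)]) auto
  \<comment> \<open>Half of the gain pays for the error, and the other half contradicts the bound by
    \<open>C\<close>, which applies because the new graph is labelled by natural numbers.\<close>
  define \<epsilon> where "\<epsilon> = resistance \<beta> ?p ?q * (1 / 4 - C) / 2"
  have \<epsilon>: "0 < \<epsilon>" "resistance \<beta> ?p ?q * (1 / 4 - C) = 2 * \<epsilon>"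
    using r C4 by (simp_all add: \<epsilon>_def)
  obtain \<Gamma>' :: "(nat, nat) mgraph" where \<Gamma>': "metrized_graph \<Gamma>'" "total_length \<Gamma>' = 1"
    "tau \<Gamma>' \<le> C - 2 * \<epsilon> + \<epsilon>"
    using tau_improvement[OF \<beta>(1,2) pq \<epsilon>(1)] unfolding \<beta>(3) \<epsilon>(2) by blast
  then have "tau \<Gamma>' < C"
    using \<epsilon>(1) by simp
  moreover have "C \<le> tau \<Gamma>'"
    using C \<Gamma>'(1,2) by force
  ultimately show False
    by simp
qed

end
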